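(* For every pair $A,B$ of effect algebras, $$A\otimes B\cong L\bigl(R(A)\otimes_{\mathrm{Day}}R(B)\bigr),$$ where $\otimes_{\mathrm{Day}}$ is the Day convolution on $[\mathbf{FinBool}^{op},\mathbf{Set}]$ induced by the coproduct $*$ on $\mathbf{FinBool}$: $$(X\otimes_{\mathrm{Day}}Y)(c)=\int^{(c_1,c_2)}\mathbf{FinBool}(c,c_1*c_2)\times X(c_1)\times Y(c_2).$$
   Context: Effect algebras are partial algebras $(A;+,0,1)$ satisfying the Foulis–Bennett axioms; one-element effect algebras are allowed. Morphisms preserve $1$ and defined sums; $\mathbf{EA}$ is the category. Boolean algebras are effect algebras via: $x+y$ is defined iff $x\wedge y=0$, and then $x+y=x\vee y$. For $[n]=\{1,\dots,n\}$, $\mathbf{FinBool}$ is the full subcategory of Boolean algebras on the objects $2^{[n]}$, $n\in\mathbb N$. $E\colon\mathbf{FinBool}\to\mathbf{EA}$ is the inclusion, and $*$ is the coproduct of Boolean algebras. $R\colon\mathbf{EA}\to[\mathbf{FinBool}^{op},\mathbf{Set}]$ is given by $R(A)(2^{[n]})=\mathbf{EA}(E(2^{[n]}),A)$ and $R(A)(f)(g)=g\circ E(f)$. $L\colon[\mathbf{FinBool}^{op},\mathbf{Set}]\to\mathbf{EA}$ is given by $L(P)=\varinjlim\bigl(\int P\xrightarrow{\pi_P}\mathbf{FinBool}\xrightarrow{E}\mathbf{EA}\bigr)$. Here $\int P$ is the category of elements of $P$: - objects: pairs $(c,x)$ with $x\in P(c)$; - arrows $(c,x)\to(c',x')$: maps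 $f\colon c\to c'$ with $P(f)(x')=x$; and $\pi_P$ is the projection. $L$ is left adjoint to $R$. A bimorphism from $A,B$ to $C$ is a map $h\colon A\times B\to C$ with $h(1,1)=1$ that is additive (preserving orthogonality and sums) in each argument separately. The tensor product $A\otimes B$ is the universal (initial) bimorphism out of $A\times B$. *)

theory Defs
  imports Main
begin

record 'a ea =
  ea_car  :: "'a set"
  ea_sum  :: "'a \<Rightarrow> 'a \<Rightarrow> 'a option"
  ea_zero :: 'a
  ea_one  :: 'a

definition effect_alg :: "'a ea \<Rightarrow> bool" where
  "effect_alg A \<longleftrightarrow>
     ea_zero A \<in> ea_car A \<and> ea_one A \<in> ea_car A \<and>
     (\<forall>a\<in>ea_car A. \<forall>b\<in>ea_car A. \<forall>c. ea_sum A a b = Some c \<longrightarrow> c \<in> ea_car A) \<and>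
     \<comment> \<open>(E1) commutativity\<close>
     (\<forall>a\<in>ea_car A. \<forall>b\<in>ea_car A. ea_sum A a b = ea_sum A b a) \<and>
     \<comment> \<open>(E2) associativity\<close>
     (\<forall>a\<in>ea_car A. \<forall>b\<in>ea_car A. \<forall>c\<in>ea_car A. \<forall>ab abc.
        ea_sum A a b = Some ab \<and> ea_sum A ab c = Some abc \<longrightarrow>
        (\<exists>bc. ea_sum A b c = Some bc \<and> ea_sum A a bc = Some abc)) \<and>
     \<comment> \<open>(E3) unique orthosupplement\<close>
     (\<forall>a\<in>ea_car A. \<exists>a'\<in>ea_car A. ea_sum A a a' = Some (ea_one A) \<and>
        (\<forall>a''\<in>ea_car A. ea_sum A a a'' = Some (ea_one A) \<longrightarrow> a'' = a')) \<and>
     \<comment> \<open>(E4) zero-one law\<close>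
     (\<forall>a\<in>ea_car A. ea_sum A a (ea_one A) \<noteq> None \<longrightarrow> a = ea_zero A)"

definition ea_hom :: "'a ea \<Rightarrow> 'b ea \<Rightarrow> ('a \<Rightarrow> 'b) \<Rightarrow> bool" where
  "ea_hom A B f \<longleftrightarrow>
     (\<forall>a\<in>ea_car A. f a \<in> ea_car B) \<and> f (ea_one A) = ea_one B \<and>
     (\<forall>a\<in>ea_car A. \<forall>b\<in>ea_car A. \<forall>c. ea_sum A a b = Some c \<longrightarrow>
        ea_sum B (f a) (f b) = Some (f c))"

definition ea_iso :: "'a ea \<Rightarrow> 'b ea \<Rightarrow> bool" where
  "ea_iso A B \<longleftrightarrow> (\<exists>f g. ea_hom A B f \<and> ea_hom B A g \<and>
      (\<forall>a\<in>ea_car A. g (f a) = a) \<and> (\<forall>b\<in>ea_car B. f (g b) = b))"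

definition bimorph :: "'a ea \<Rightarrow> 'b ea \<Rightarrow> 'c ea \<Rightarrow> ('a \<Rightarrow> 'b \<Rightarrow> 'c) \<Rightarrow> bool" where
  "bimorph A B C h \<longleftrightarrow>
     (\<forall>a\<in>ea_car A. \<forall>b\<in>ea_car B. h a b \<in> ea_car C) \<and>
     h (ea_one A) (ea_one B) = ea_one C \<and>
     (\<forall>b\<in>ea_car B. \<forall>a1\<in>ea_car A. \<forall>a2\<in>ea_car A. \<forall>a. ea_sum A a1 a2 = Some a \<longrightarrow>
        ea_sum C (h a1 b) (h a2 b) = Some (h a b)) \<and>
     (\<forall>a\<in>ea_car A. \<forall>b1\<in>ea_car B. \<forall>b2\<in>ea_car B. \<forall>b. ea_sum B b1 b2 = Some b \<longrightarrow>
        ea_sum C (h a b1) (h a b2) = Some (h a b))"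

definition is_tensor :: "'a ea \<Rightarrow> 'b ea \<Rightarrow> 'c ea \<Rightarrow> ('a \<Rightarrow> 'b \<Rightarrow> 'c) \<Rightarrow> 'd itself \<Rightarrow> bool" where
  "is_tensor A B C h (_::'d itself) \<longleftrightarrow>
     effect_alg C \<and> bimorph A B C h \<and>
     (\<forall>(D::'d ea) k. effect_alg D \<and> bimorph A B D k \<longrightarrow>
        (\<exists>u. ea_hom C D u \<and> (\<forall>a\<in>ea_car A. \<forall>b\<in>ea_car B. u (h a b) = k a b)) \<and>
        (\<forall>u v. ea_hom C D u \<and> (\<forall>a\<in>ea_car A. \<forall>b\<in>ea_car B. u (h a b) = k a b) \<and>
               ea_hom C D v \<and> (\<forall>a\<in>ea_car A. \<forall>b\<in>ea_car B. v (h a b) = k a b) \<longrightarrow>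
               (\<forall>z\<in>ea_car C. u z = v z)))"

text \<open>The object 2^[n] is represented by the natural number n; its elements are the
  subsets of {1..n}.  Morphisms 2^[m] -> 2^[n] are Boolean algebra homomorphisms,
  represented extensionally (value {} outside Pow {1..m}).\<close>

definition boolEA :: "nat \<Rightarrow> nat set ea" where
  "boolEA n = \<lparr> ea_car = Pow {1..n},
               ea_sum = (\<lambda>X Y. if X \<inter> Y = {} then Some (X \<union> Y) else None),
               ea_zero = {}, ea_one = {1..n} \<rparr>"

definition bhom :: "nat \<Rightarrow> nat \<Rightarrow> (nat set \<Rightarrow> nat set) \<Rightarrow> bool" where
  "bhom m n f \<longleftrightarrow>
     (\<forall>X\<in>Pow {1..m}. f X \<in> Pow {1..n}) \<and>
     f {} = {} \<and> f {1..m} = {1..n} \<and>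
     (\<forall>X\<in>Pow {1..m}. \<forall>Y\<in>Pow {1..m}. f (X \<union> Y) = f X \<union> f Y \<and> f (X \<inter> Y) = f X \<inter> f Y) \<and>
     (\<forall>X. X \<notin> Pow {1..m} \<longrightarrow> f X = {})"

text \<open>Chosen coproduct 2^[n1] * 2^[n2] := 2^[n1*n2]; the atom (a,b) of the coproduct
  (a in [n1], b in [n2]) is encoded as (a-1)*n2+b.\<close>

definition enc :: "nat \<Rightarrow> nat \<Rightarrow> nat \<Rightarrow> nat" where
  "enc n2 a b = (a - 1) * n2 + b"

definition inj1 :: "nat \<Rightarrow> nat \<Rightarrow> nat set \<Rightarrow> nat set" where
  "inj1 n1 n2 S = (if S \<in> Pow {1..n1} then {enc n2 a b | a b. a \<in> S \<and> b \<in> {1..n2}} else {})"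

definition inj2 :: "nat \<Rightarrow> nat \<Rightarrow> nat set \<Rightarrow> nat set" where
  "inj2 n1 n2 T = (if T \<in> Pow {1..n2} then {enc n2 a b | a b. a \<in> {1..n1} \<and> b \<in> T} else {})"

text \<open>The coproduct g1 * g2 : 2^[n1] * 2^[n2] -> 2^[d1] * 2^[d2] of g1 : n1 -> d1, g2 : n2 -> d2.\<close>

definition cmap :: "nat \<Rightarrow> nat \<Rightarrow> nat \<Rightarrow> nat \<Rightarrow> (nat set \<Rightarrow> nat set) \<Rightarrow> (nat set \<Rightarrow> nat set)
                    \<Rightarrow> nat set \<Rightarrow> nat set" where
  "cmap n1 n2 d1 d2 g1 g2 S =
     (if S \<in> Pow {1..n1 * n2} then
        \<Union>{inj1 d1 d2 (g1 {a}) \<inter> inj2 d1 d2 (g2 {b}) | a b.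
            a \<in> {1..n1} \<and> b \<in> {1..n2} \<and> enc n2 a b \<in> S}
      else {})"

text \<open>A presheaf P: pob P n = P(2^[n]); for f : 2^[m] -> 2^[n], pmap P m n f : P(2^[n]) -> P(2^[m]).\<close>

record 'x psh =
  pob  :: "nat \<Rightarrow> 'x set"
  pmap :: "nat \<Rightarrow> nat \<Rightarrow> (nat set \<Rightarrow> nat set) \<Rightarrow> 'x \<Rightarrow> 'x"

definition RR :: "'a ea \<Rightarrow> (nat set \<Rightarrow> 'a) psh" where
  "RR A = \<lparr> pob = (\<lambda>n. {g. ea_hom (boolEA n) A g \<and> (\<forall>X. X \<notin> Pow {1..n} \<longrightarrow> g X = undefined)}),
            pmap = (\<lambda>m n f g. (\<lambda>X. if X \<in> Pow {1..m} then g (f X) else undefined)) \<rparr>"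

type_synonym ('x,'y) dtuple = "nat \<times> nat \<times> (nat set \<Rightarrow> nat set) \<times> 'x \<times> 'y"

definition day_dom :: "'x psh \<Rightarrow> 'y psh \<Rightarrow> nat \<Rightarrow> ('x,'y) dtuple set" where
  "day_dom X Y n = {(n1, n2, f, x, y). bhom n (n1 * n2) f \<and> x \<in> pob X n1 \<and> y \<in> pob Y n2}"

definition day_step :: "'x psh \<Rightarrow> 'y psh \<Rightarrow> nat \<Rightarrow> (('x,'y) dtuple \<times> ('x,'y) dtuple) set" where
  "day_step X Y n = {((d1, d2, cmap n1 n2 d1 d2 g1 g2 \<circ> f, x, y),
                      (n1, n2, f, pmap X n1 d1 g1 x, pmap Y n2 d2 g2 y)) |
                     n1 n2 d1 d2 g1 g2 f x y.
       bhom n1 d1 g1 \<and> bhom n2 d2 g2 \<and> bhom n (n1 * n2) f \<and>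
       x \<in> pob X d1 \<and> y \<in> pob Y d2}"

definition day_rel :: "'x psh \<Rightarrow> 'y psh \<Rightarrow> nat \<Rightarrow> (('x,'y) dtuple \<times> ('x,'y) dtuple) set" where
  "day_rel X Y n = (day_step X Y n \<union> (day_step X Y n)\<inverse>)\<^sup>*"

definition Day :: "'x psh \<Rightarrow> 'y psh \<Rightarrow> ('x,'y) dtuple set psh" where
  "Day X Y = \<lparr> pob = (\<lambda>n. day_dom X Y n // day_rel X Y n),
               pmap = (\<lambda>m n h C. the_elem
                   ((\<lambda>(n1, n2, f, x, y). day_rel X Y m `` {(n1, n2, f \<circ> h, x, y)}) ` C)) \<rparr>"

section \<open>L(P): colimit of E o pi_P over the category of elements\<close>

text \<open>A cocone over E o pi_P with vertex D: an EA morphism phi n x : 2^[n] -> D for each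
  object (n,x) of the category of elements, compatible with every arrow
  f : (n,x) -> (n',x'), i.e. f : 2^[n] -> 2^[n'] with P(f)(x') = x.\<close>

definition cocone :: "'x psh \<Rightarrow> 'd ea \<Rightarrow> (nat \<Rightarrow> 'x \<Rightarrow> nat set \<Rightarrow> 'd) \<Rightarrow> bool" where
  "cocone P D phi \<longleftrightarrow>
     (\<forall>n x. x \<in> pob P n \<longrightarrow> ea_hom (boolEA n) D (phi n x)) \<and>
     (\<forall>n n' x' f. x' \<in> pob P n' \<and> bhom n n' f \<longrightarrow>
        (\<forall>S\<in>Pow {1..n}. phi n' x' (f S) = phi n (pmap P n n' f x') S))"

definition is_colimit :: "'x psh \<Rightarrow> 'l ea \<Rightarrow> (nat \<Rightarrow> 'x \<Rightarrow> nat set \<Rightarrow> 'l) \<Rightarrow> 'd itself \<Rightarrow> bool" where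
  "is_colimit P L lam (_::'d itself) \<longleftrightarrow>
     effect_alg L \<and> cocone P L lam \<and>
     (\<forall>(D::'d ea) phi. effect_alg D \<and> cocone P D phi \<longrightarrow>
        (\<exists>u. ea_hom L D u \<and> (\<forall>n x. x \<in> pob P n \<longrightarrow> (\<forall>S\<in>Pow {1..n}. u (lam n x S) = phi n x S))) \<and>
        (\<forall>u v. ea_hom L D u \<and> (\<forall>n x. x \<in> pob P n \<longrightarrow> (\<forall>S\<in>Pow {1..n}. u (lam n x S) = phi n x S)) \<and>
               ea_hom L D v \<and> (\<forall>n x. x \<in> pob P n \<longrightarrow> (\<forall>S\<in>Pow {1..n}. v (lam n x S) = phi n x S)) \<longrightarrow>
               (\<forall>z\<in>ea_car L. u z = v z)))"

end

theory Submission
  imports Defs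
begin

text \<open>Both objects represent the same functor. An effect algebra morphism out of \<open>2^[n]\<close> is
  an \<open>n\<close>-tuple summing to \<open>1\<close>, so a bimorphism out of \<open>2^[n1], 2^[n2]\<close> is the same as a morphism
  out of \<open>2^[n1] * 2^[n2] = 2^[n1*n2]\<close>. Precomposing a bimorphism \<open>k\<close> out of \<open>A, B\<close> with
  \<open>x \<in> R A n1\<close> and \<open>y \<in> R B n2\<close> therefore yields a cocone on the Day convolution.
  Conversely, elements \<open>a\<close>, \<open>b\<close> are morphisms from \<open>2^[2]\<close>, and a cocone restricted to
  the pairs \<open>(a, b)\<close> is a bimorphism; additivity is read off the morphisms from \<open>2^[3]\<close>
  given by \<open>a1, a2, (a1 + a2)\<bottom>\<close>.\<close>

section \<open>Finite sums in an effect algebra\<close>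

lemma bool_hom_simps:
  assumes "ea_hom (boolEA n) D g"
  shows "S \<subseteq> {1..n} \<Longrightarrow> g S \<in> ea_car D"
    and "g {1..n} = ea_one D"
    and "S \<subseteq> {1..n} \<Longrightarrow> T \<subseteq> {1..n} \<Longrightarrow> S \<inter> T = {} \<Longrightarrow> ea_sum D (g S) (g T) = Some (g (S \<union> T))"
  using assms by (auto simp: ea_hom_def boolEA_def)

locale effect_algebra =
  fixes D :: "'d ea"
  assumes effect_alg: "effect_alg D"
begin

lemma zero_closed: "ea_zero D \<in> ea_car D"
  and one_closed: "ea_one D \<in> ea_car D"
  and sum_closed: "a \<in> ea_car D \<Longrightarrow> b \<in> ea_car D \<Longrightarrow> ea_sum D a b = Some c \<Longrightarrow> c \<in> ea_car D"
  and sum_commute: "a \<in> ea_car D \<Longrightarrow> b \<in> ea_car D \<Longrightarrow> ea_sum D a b = ea_sum D b a"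
  and sum_assoc: "a \<in> ea_car D \<Longrightarrow> b \<in> ea_car D \<Longrightarrow> c \<in> ea_car D \<Longrightarrow>
    ea_sum D a b = Some ab \<Longrightarrow> ea_sum D ab c = Some abc \<Longrightarrow>
    \<exists>bc. ea_sum D b c = Some bc \<and> ea_sum D a bc = Some abc"
  and orthosupplement: "a \<in> ea_car D \<Longrightarrow> \<exists>a'\<in>ea_car D. ea_sum D a a' = Some (ea_one D)"
  and orthosupplement_unique: "a \<in> ea_car D \<Longrightarrow> b \<in> ea_car D \<Longrightarrow> c \<in> ea_car D \<Longrightarrow>
    ea_sum D a b = Some (ea_one D) \<Longrightarrow> ea_sum D a c = Some (ea_one D) \<Longrightarrow> b = c"
  and zero_one_law: "a \<in> ea_car D \<Longrightarrow> ea_sum D a (ea_one D) = Some b \<Longrightarrow> a = ea_zero D"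
  using effect_alg unfolding effect_alg_def by blast+

text \<open>Adding the orthosupplement \<open>c'\<close> to \<open>c + c = c\<close> and
  reassociating gives \<open>c + 1 = 1\<close>, so the zero-one law applies.\<close>

lemma idempotent_zero:
  assumes "c \<in> ea_car D" "ea_sum D c c = Some c"
  shows "c = ea_zero D"
proof -
  obtain c' where c': "c' \<in> ea_car D" "ea_sum D c c' = Some (ea_one D)"
    using orthosupplement assms(1) by blast
  then show ?thesis
    using sum_assoc[OF assms(1) assms(1) c'(1) assms(2) c'(2)] zero_one_law[OF assms(1)] by auto
qed

text \<open>The orthosupplement of \<open>1\<close> is \<open>0\<close> by the zero-one law, so
  \<open>1 + 0 = 1\<close>. With \<open>a'\<close> the orthosupplement of \<open>a\<close>,
  reassociating \<open>(a' + a) + 0 = 1\<close> makes \<open>a + 0\<close> an orthosupplement of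
  \<open>a'\<close>, hence equal to \<open>a\<close>.\<close>

lemma zero_sum:
  assumes a: "a \<in> ea_car D"
  shows "ea_sum D (ea_zero D) a = Some a"
proof -
  obtain z where z: "z \<in> ea_car D" "ea_sum D (ea_one D) z = Some (ea_one D)"
    using orthosupplement[OF one_closed] by blast
  then have "z = ea_zero D"
    by (metis one_closed sum_commute zero_one_law)
  with z have one_zero: "ea_sum D (ea_one D) (ea_zero D) = Some (ea_one D)" by simp
  obtain a' where a': "a' \<in> ea_car D" "ea_sum D a a' = Some (ea_one D)"
    using orthosupplement[OF a] by blast
  have a'a: "ea_sum D a' a = Some (ea_one D)"
    using a' a sum_commute by simp
  obtain b where b: "ea_sum D a (ea_zero D) = Some b" "ea_sum D a' b = Some (ea_one D)"
    using sum_assoc[OF a'(1) a zero_closed a'a one_zero] by blast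
  have "b \<in> ea_car D"
    using b(1) a zero_closed sum_closed by blast
  then have "b = a"
    using orthosupplement_unique[OF a'(1) _ a b(2) a'a] by blast
  then show ?thesis
    using b(1) a zero_closed sum_commute by simp
qed

text \<open>Positivity: \<open>(a + b) + 1 = 0 + 1\<close> is defined, so by associativity
  \<open>b + 1\<close> is defined and the zero-one law applies.\<close>

lemma sum_zero_cancel:
  assumes "a \<in> ea_car D" "b \<in> ea_car D" "ea_sum D a b = Some (ea_zero D)"
  shows "b = ea_zero D"
  using sum_assoc[OF assms(1,2) one_closed assms(3) zero_sum[OF one_closed]]
    zero_one_law[OF assms(2)] by blast

text \<open>The partial sum, totalised with \<^term>\<open>None\<close> as an absorbing element. The case distinction on
  \<^term>\<open>ea_zero D\<close> makes it a unit for junk outside the carrier as well, as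
  \<^term>\<open>comm_monoid_set\<close> demands.\<close>
definition osum :: "'d option \<Rightarrow> 'd option \<Rightarrow> 'd option" where
  "osum x y = (if x = Some (ea_zero D) then y else if y = Some (ea_zero D) then x
     else if x \<in> Some ` ea_car D \<and> y \<in> Some ` ea_car D then ea_sum D (the x) (the y) else None)"

lemma osum_Some:
  "a \<in> ea_car D \<Longrightarrow> b \<in> ea_car D \<Longrightarrow> osum (Some a) (Some b) = ea_sum D a b"
  using zero_sum sum_commute[OF zero_closed] by (auto simp: osum_def)

lemma osum_None [simp]: "osum None y = None" "osum x None = None"
  by (auto simp: osum_def)

lemma osum_zero [simp]: "osum (Some (ea_zero D)) y = y" "osum x (Some (ea_zero D)) = x"
  by (auto simp: osum_def)

text \<open>Positivity for the totalised sum. It keeps the unit clauses of \<open>osum\<close> from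
  interfering in \<open>osum_assoc\<close>: non-units never add up to the unit.\<close>

lemma osum_eq_zero:
  assumes "osum x y = Some (ea_zero D)"
  shows "x = Some (ea_zero D) \<and> y = Some (ea_zero D)"
proof -
  consider "x = Some (ea_zero D)" | "y = Some (ea_zero D)"
    | a b where "x = Some a" "y = Some b" "a \<in> ea_car D" "b \<in> ea_car D"
      "ea_sum D a b = Some (ea_zero D)"
  proof -
    assume *: thesis if "x = Some (ea_zero D)"
    assume **: thesis if "y = Some (ea_zero D)"
    assume ***: thesis if "x = Some a" "y = Some b" "a \<in> ea_car D" "b \<in> ea_car D"
      "ea_sum D a b = Some (ea_zero D)" for a b
    show thesis
      using * ** ***[of "the x" "the y"] assms by (auto simp: osum_def split: if_splits)
  qed
  then show ?thesis
  proof cases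
    case 3
    then show ?thesis
      by (metis sum_zero_cancel sum_commute)
  qed (use assms in auto)
qed

lemma osum_junk:
  "x \<notin> Some ` ea_car D \<Longrightarrow> y \<noteq> Some (ea_zero D) \<Longrightarrow> osum x y = None"
  "x \<notin> Some ` ea_car D \<Longrightarrow> y \<noteq> Some (ea_zero D) \<Longrightarrow> osum y x = None"
  using zero_closed by (auto simp: osum_def)

lemma osum_commute: "osum x y = osum y x"
  by (auto simp: osum_def intro: sum_commute)

text \<open>Axiom (E2) carries definedness from the left bracketing to the right one; this is the
  direction it yields directly.\<close>

lemma osum_assoc_Some:
  assumes "a \<in> ea_car D" "b \<in> ea_car D" "c \<in> ea_car D"
    and "osum (osum (Some a) (Some b)) (Some c) = Some d"
  shows "osum (Some a) (osum (Some b) (Some c)) = Some d"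
proof -
  obtain ab where ab: "ea_sum D a b = Some ab"
    using assms by (cases "ea_sum D a b") (auto simp: osum_Some)
  then have "ab \<in> ea_car D"
    using assms sum_closed by blast
  then have "ea_sum D ab c = Some d"
    using assms ab by (simp add: osum_Some)
  then obtain bc where bc: "ea_sum D b c = Some bc" "ea_sum D a bc = Some d"
    using sum_assoc assms ab by blast
  then have "bc \<in> ea_car D"
    using assms sum_closed by blast
  then show ?thesis
    using assms bc by (simp add: osum_Some)
qed

lemma osum_assoc: "osum (osum x y) z = osum x (osum y z)"
proof (cases "x \<in> Some ` ea_car D \<and> y \<in> Some ` ea_car D \<and> z \<in> Some ` ea_car D")
  case True
  then obtain a b c where abc: "x = Some a" "y = Some b" "z = Some c"
    "a \<in> ea_car D" "b \<in> ea_car D" "c \<in> ea_car D" by blast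
  have "osum x (osum y z) = Some d" if "osum (osum x y) z = Some d" for d
    using osum_assoc_Some[of a b c d] abc that by simp
  \<comment> \<open>Commutativity reverses the triple, so the same lemma gives the other
    direction.\<close>
  moreover have "osum (osum x y) z = Some d" if "osum x (osum y z) = Some d" for d
  proof -
    have "osum (osum z y) x = Some d"
      using that by (simp add: osum_commute)
    then have "osum z (osum y x) = Some d"
      using osum_assoc_Some[of c b a d] abc by simp
    then show ?thesis by (simp add: osum_commute)
  qed
  ultimately show ?thesis
    by (cases "osum (osum x y) z"; cases "osum x (osum y z)") auto
next
  case False
  let ?z = "Some (ea_zero D)"
  consider "x = ?z \<or> y = ?z \<or> z = ?z" | "x \<noteq> ?z" "y \<noteq> ?z" "z \<noteq> ?z" by blast
  then show ?thesis
  proof cases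
    case 2
    \<comment> \<open>Since the inner sums are not the unit, one argument outside the carrier turns
      both sides into \<open>None\<close>.\<close>
    then have "osum x y \<noteq> ?z" "osum y z \<noteq> ?z"
      using osum_eq_zero by blast+
    with 2 False show ?thesis
      by (metis osum_junk osum_None)
  qed auto
qed

text \<open>Finite sums inherit reindexing, disjoint unions and double sums from commutative
  monoids; \<open>None\<close> records that a sum is undefined.\<close>

sublocale esum: comm_monoid_set osum "Some (ea_zero D)"
  defines esum = esum.F
  by unfold_locales (auto simp: osum_assoc intro: osum_commute)

text \<open>Induction over the atoms of \<open>S\<close>. The value at the full set is left
  arbitrary, since \<open>tensor_hom\<close> applies this to \<open>k (x {a}) (y V)\<close> as a
  function of \<open>V\<close>, whose total is \<open>k (x {a}) 1\<close>.\<close>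

lemma additive_esum:
  assumes car: "\<And>X. X \<in> Pow I \<Longrightarrow> g X \<in> ea_car D"
    and add: "\<And>X Y. X \<in> Pow I \<Longrightarrow> Y \<in> Pow I \<Longrightarrow> X \<inter> Y = {} \<Longrightarrow>
      ea_sum D (g X) (g Y) = Some (g (X \<union> Y))"
    and "finite S" "S \<subseteq> I"
  shows "esum (\<lambda>i. Some (g {i})) S = Some (g S)"
  using assms(3,4)
proof induction
  case empty
  \<comment> \<open>Additivity at the disjoint pair \<open>{}\<close>, \<open>{}\<close> makes
    \<open>g {}\<close> idempotent.\<close>
  have "g {} = ea_zero D"
    using idempotent_zero[of "g {}"] car add[of "{}" "{}"] by simp
  then show ?case by simp
next
  case (insert i S)
  then have "osum (Some (g {i})) (Some (g S)) = Some (g (insert i S))"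
    using car add[of "{i}" S] by (simp add: osum_Some)
  with insert show ?case by simp
qed

text \<open>\<open>None\<close> is absorbing, so an undefined partial sum would make the whole sum
  undefined.\<close>

lemma esum_subset_Some:
  assumes "finite I" "esum g I = Some d" "S \<subseteq> I"
  obtains e where "esum g S = Some e"
  using esum.subset_diff[OF assms(3,1), of g] assms(2)
  by (cases "esum g S") auto

lemma esum_closed:
  assumes "finite S" "\<And>i. i \<in> S \<Longrightarrow> f i \<in> ea_car D" "esum (\<lambda>i. Some (f i)) S = Some d"
  shows "d \<in> ea_car D"
  using assms
proof (induction arbitrary: d)
  case empty
  then show ?case using zero_closed by simp
next
  case (insert i S)
  then obtain e where e: "esum (\<lambda>i. Some (f i)) S = Some e"
    by (cases "esum (\<lambda>i. Some (f i)) S") auto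
  with insert have "e \<in> ea_car D" "ea_sum D (f i) e = Some d"
    by (auto simp: osum_Some)
  then show ?case
    using insert.prems sum_closed by blast
qed

text \<open>\<^term>\<open>undefined\<close> outside the carrier, so that these maps are elements of \<^term>\<open>RR D\<close>.\<close>
definition tuple_hom :: "nat \<Rightarrow> (nat \<Rightarrow> 'd) \<Rightarrow> nat set \<Rightarrow> 'd" where
  "tuple_hom n f S = (if S \<in> Pow {1..n} then the (esum (\<lambda>i. Some (f i)) S) else undefined)"

text \<open>All partial sums are defined because the total is; additivity is then the splitting of a
  sum over a disjoint union.\<close>

lemma tuple_hom:
  assumes f: "\<And>i. i \<in> {1..n} \<Longrightarrow> f i \<in> ea_car D"
    and one: "esum (\<lambda>i. Some (f i)) {1..n} = Some (ea_one D)"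
  shows "ea_hom (boolEA n) D (tuple_hom n f)"
    and "S \<subseteq> {1..n} \<Longrightarrow> esum (\<lambda>i. Some (f i)) S = Some (tuple_hom n f S)"
    and "tuple_hom n f \<in> pob (RR D) n"
proof -
  have val: "esum (\<lambda>i. Some (f i)) S = Some (tuple_hom n f S)" if S: "S \<subseteq> {1..n}" for S
  proof -
    obtain e where "esum (\<lambda>i. Some (f i)) S = Some e"
      using esum_subset_Some[OF finite_atLeastAtMost one S] .
    with S show ?thesis by (simp add: tuple_hom_def)
  qed
  have car: "tuple_hom n f S \<in> ea_car D" if "S \<subseteq> {1..n}" for S
    by (rule esum_closed[OF finite_subset[OF that] _ val[OF that]]) (use f that in auto)
  have "ea_sum D (tuple_hom n f S) (tuple_hom n f T) = Some (tuple_hom n f (S \<union> T))"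
    if "S \<subseteq> {1..n}" "T \<subseteq> {1..n}" "S \<inter> T = {}" for S T
  proof -
    have "esum (\<lambda>i. Some (f i)) (S \<union> T) =
        osum (esum (\<lambda>i. Some (f i)) S) (esum (\<lambda>i. Some (f i)) T)"
      using that finite_subset[OF that(1)] finite_subset[OF that(2)]
      by (intro esum.union_disjoint) auto
    with that show ?thesis
      by (simp add: val car osum_Some)
  qed
  with car show "ea_hom (boolEA n) D (tuple_hom n f)"
    using val[of "{1..n}"] one by (auto simp: ea_hom_def boolEA_def split: if_splits)
  then show "tuple_hom n f \<in> pob (RR D) n"
    by (simp add: RR_def tuple_hom_def)
  show "S \<subseteq> {1..n} \<Longrightarrow> esum (\<lambda>i. Some (f i)) S = Some (tuple_hom n f S)"
    by (rule val)
qed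

lemma bool_hom_esum:
  assumes "ea_hom (boolEA n) D g" "S \<subseteq> {1..n}"
  shows "esum (\<lambda>i. Some (g {i})) S = Some (g S)"
  using additive_esum[where I="{1..n}" and g=g and S=S] bool_hom_simps[OF assms(1)] assms(2)
    finite_subset[OF assms(2)] by auto

lemma bool_hom_eqI:
  assumes "ea_hom (boolEA n) D g" "ea_hom (boolEA n) D g'"
    and "\<And>i. i \<in> {1..n} \<Longrightarrow> g {i} = g' {i}" and S: "S \<subseteq> {1..n}"
  shows "g S = g' S"
proof -
  have "esum (\<lambda>i. Some (g {i})) S = esum (\<lambda>i. Some (g' {i})) S"
    using assms(3) S by (intro esum.cong) auto
  then show ?thesis
    using bool_hom_esum[OF assms(1) S] bool_hom_esum[OF assms(2) S] by simp
qed

section \<open>Elements and summable pairs as morphisms from \<open>2^[2]\<close> and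
  \<open>2^[3]\<close>\<close>

lemma ex_RR_3:
  assumes "a1 \<in> ea_car D" "a2 \<in> ea_car D" "ea_sum D a1 a2 = Some a"
  obtains x where "x \<in> pob (RR D) 3" "x {1} = a1" "x {2} = a2" "x {1,2} = a"
proof -
  have a: "a \<in> ea_car D"
    using assms sum_closed by blast
  then obtain a' where a': "a' \<in> ea_car D" "ea_sum D a a' = Some (ea_one D)"
    using orthosupplement by blast
  define f where "f i = (if i = 1 then a1 else if i = 2 then a2 else a')" for i :: nat
  \<comment> \<open>Listing \<open>3\<close> first splits the sum as \<open>a' + (a1 + a2)\<close>,
    whose inner part is already known to be \<open>a\<close>.\<close>
  have i3: "{1..3::nat} = {3,1,2}" by auto
  have e12: "esum (\<lambda>i. Some (f i)) {1,2} = Some a"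
    using assms by (simp add: f_def osum_Some)
  have "esum (\<lambda>i. Some (f i)) {1..3} = osum (Some a') (esum (\<lambda>i. Some (f i)) {1,2})"
    unfolding i3 by (subst esum.insert) (auto simp: f_def)
  then have "esum (\<lambda>i. Some (f i)) {1..3} = Some (ea_one D)"
    using a' a e12 sum_commute[of a a'] by (simp add: osum_Some)
  note th = tuple_hom[OF _ this]
  have f: "i \<in> {1..3} \<Longrightarrow> f i \<in> ea_car D" for i
    using assms a' by (auto simp: f_def)
  show ?thesis
  proof (rule that)
    show "tuple_hom 3 f \<in> pob (RR D) 3" using th(3) f by blast
    have "f 1 = a1" "f 2 = a2" by (simp_all add: f_def)
    then show "tuple_hom 3 f {1} = a1" "tuple_hom 3 f {2} = a2"
      using th(2)[OF f, of "{1}"] th(2)[OF f, of "{2}"] by simp_all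
    show "tuple_hom 3 f {1,2} = a"
      using th(2)[OF f, of "{1,2}"] e12 by auto
  qed
qed

text \<open>Existence comes from the pair of \<open>a\<close> and its orthosupplement. For
  uniqueness, the value at \<open>{2}\<close> must be that orthosupplement, and elements of
  \<open>RR D\<close> are \<open>undefined\<close> off \<open>Pow {1..2}\<close>.\<close>

lemma ex1_RR_2:
  assumes a: "a \<in> ea_car D"
  shows "\<exists>!x. x \<in> pob (RR D) 2 \<and> x {1} = a"
proof (rule ex_ex1I)
  obtain a' where a': "a' \<in> ea_car D" "ea_sum D a a' = Some (ea_one D)"
    using orthosupplement a by blast
  define f where "f i = (if i = 1 then a else a')" for i :: nat
  have i2: "{1..2::nat} = {1,2}" by auto
  have "esum (\<lambda>i. Some (f i)) {1..2} = Some (ea_one D)"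
    using a a' unfolding i2 by (simp add: f_def osum_Some)
  note th = tuple_hom[OF _ this]
  have f: "i \<in> {1..2} \<Longrightarrow> f i \<in> ea_car D" for i
    using a a' by (auto simp: f_def)
  show "\<exists>x. x \<in> pob (RR D) 2 \<and> x {1} = a"
    using th(3)[OF f] th(2)[OF f, of "{1}"] by (auto simp: f_def)
next
  fix x y assume xy: "x \<in> pob (RR D) 2 \<and> x {1} = a" "y \<in> pob (RR D) 2 \<and> y {1} = a"
  then have hom: "ea_hom (boolEA 2) D x" "ea_hom (boolEA 2) D y"
    by (auto simp: RR_def)
  have un: "{1} \<union> {2} = {1..2::nat}" by auto
  have "ea_sum D a (x {2}) = Some (ea_one D)" "ea_sum D a (y {2}) = Some (ea_one D)"
    using bool_hom_simps(2)[OF hom(1)] bool_hom_simps(3)[OF hom(1), of "{1}" "{2}"]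
      bool_hom_simps(2)[OF hom(2)] bool_hom_simps(3)[OF hom(2), of "{1}" "{2}"] xy
    unfolding un by auto
  then have "x {2} = y {2}"
    using orthosupplement_unique[OF a] bool_hom_simps(1)[OF hom(1), of "{2}"]
      bool_hom_simps(1)[OF hom(2), of "{2}"] by auto
  then have "x {i} = y {i}" if "i \<in> {1..2}" for i
    using that xy un by (metis Un_iff singletonD)
  then have "x S = y S" if "S \<subseteq> {1..2}" for S
    using bool_hom_eqI[OF hom] that by blast
  then show "x = y"
    using xy by (auto simp: RR_def fun_eq_iff) (metis)
qed

end

section \<open>Boolean morphisms as preimages\<close>

text \<open>The dual of a function \<open>p\<close> from \<open>[n]\<close> to \<open>[m]\<close>;
  the default \<open>{}\<close> is the one prescribed by \<open>bhom\<close>.\<close>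

definition preim :: "nat \<Rightarrow> nat \<Rightarrow> (nat \<Rightarrow> nat) \<Rightarrow> nat set \<Rightarrow> nat set" where
  "preim m n p X = (if X \<in> Pow {1..m} then {j \<in> {1..n}. p j \<in> X} else {})"

lemma bhom_preim: "p ` {1..n} \<subseteq> {1..m} \<Longrightarrow> bhom m n (preim m n p)"
  unfolding bhom_def preim_def by auto

lemma bhom_subset: "bhom m n f \<Longrightarrow> f X \<subseteq> {1..n}"
  unfolding bhom_def by (cases "X \<in> Pow {1..m}") auto

lemma bhom_Un:
  "bhom m n f \<Longrightarrow> X \<subseteq> {1..m} \<Longrightarrow> Y \<subseteq> {1..m} \<Longrightarrow> f (X \<union> Y) = f X \<union> f Y"
  and bhom_Int:
  "bhom m n f \<Longrightarrow> X \<subseteq> {1..m} \<Longrightarrow> Y \<subseteq> {1..m} \<Longrightarrow> f (X \<inter> Y) = f X \<inter> f Y"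
  by (simp_all add: bhom_def)

lemma bhom_empty: "bhom m n f \<Longrightarrow> f {} = {}"
  and bhom_top: "bhom m n f \<Longrightarrow> f {1..m} = {1..n}"
  and bhom_outside: "bhom m n f \<Longrightarrow> \<not> X \<subseteq> {1..m} \<Longrightarrow> f X = {}"
  by (simp_all add: bhom_def)

text \<open>Finite Stone duality: the images \<open>f {i}\<close> of the atoms are disjoint and
  cover \<open>[n]\<close>, and \<open>p j\<close> is the index of the block containing
  \<open>j\<close>.\<close>

lemma bhom_eq_preim:
  assumes f: "bhom m n f"
  obtains p where "p ` {1..n} \<subseteq> {1..m}" "f = preim m n p"
proof -
  have un: "f X = (\<Union>i\<in>X. f {i})" if "finite X" "X \<subseteq> {1..m}" for X
    using that
  proof induction
    case (insert i X)
    then have "f ({i} \<union> X) = f {i} \<union> f X"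
      by (intro bhom_Un[OF f]) auto
    with insert show ?case by simp
  qed (simp add: bhom_empty[OF f])
  have "{1..n} = (\<Union>i\<in>{1..m}. f {i})"
    using un[of "{1..m}"] bhom_top[OF f] by simp
  then have "\<forall>j\<in>{1..n}. \<exists>i\<in>{1..m}. j \<in> f {i}" by blast
  then obtain p where p: "\<And>j. j \<in> {1..n} \<Longrightarrow> p j \<in> {1..m} \<and> j \<in> f {p j}"
    by metis
  have disj: "f {i} \<inter> f {i'} = {}" if "i \<in> {1..m}" "i' \<in> {1..m}" "i \<noteq> i'" for i i'
  proof -
    have "f ({i} \<inter> {i'}) = f {i} \<inter> f {i'}"
      using that by (intro bhom_Int[OF f]) auto
    then show ?thesis
      using that bhom_empty[OF f] by simp
  qed
  have "f X = preim m n p X" for X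
  proof (cases "X \<subseteq> {1..m}")
    case True
    have "f X \<subseteq> {1..n}"
      by (rule bhom_subset[OF f])
    moreover have "j \<in> f X \<longleftrightarrow> p j \<in> X" if j: "j \<in> {1..n}" for j
    proof
      assume "j \<in> f X"
      then obtain i where i: "i \<in> X" "j \<in> f {i}"
        using un[of X] True finite_subset by blast
      then have "i = p j"
        using disj[of i "p j"] p[OF j] True by blast
      with i show "p j \<in> X" by simp
    next
      assume "p j \<in> X"
      then show "j \<in> f X"
        using un[of X] True finite_subset p[OF j] by blast
    qed
    ultimately show ?thesis
      using True by (auto simp: preim_def)
  next
    case False
    then show ?thesis
      using bhom_outside[OF f] by (simp add: preim_def)
  qed
  then have "f = preim m n p" by (rule ext)
  then show ?thesis
    using that[of p] p by blast
qed

lemma bhom_comp: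
  assumes "bhom m n f" "bhom n k g"
  shows "bhom m k (g \<circ> f)"
  unfolding bhom_def
  using bhom_subset[OF assms(1)] bhom_subset[OF assms(2)]
  by (simp add: bhom_Un[OF assms(1)] bhom_Un[OF assms(2)] bhom_Int[OF assms(1)]
    bhom_Int[OF assms(2)] bhom_top[OF assms(1)] bhom_top[OF assms(2)]
    bhom_empty[OF assms(1)] bhom_empty[OF assms(2)] bhom_outside[OF assms(1)]
    del: One_nat_def)

lemma ea_hom_comp_bhom:
  assumes f: "bhom m n f" and g: "ea_hom (boolEA n) D g"
  shows "ea_hom (boolEA m) D (g \<circ> f)"
proof -
  have "ea_sum D (g (f S)) (g (f T)) = Some (g (f (S \<union> T)))"
    if "S \<subseteq> {1..m}" "T \<subseteq> {1..m}" "S \<inter> T = {}" for S T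
  proof -
    have "f (S \<union> T) = f S \<union> f T" "f S \<inter> f T = f (S \<inter> T)"
      using that bhom_Un[OF f, of S T] bhom_Int[OF f, of S T] by simp_all
    then show ?thesis
      using bool_hom_simps(3)[OF g, of "f S" "f T"] that bhom_subset[OF f] bhom_empty[OF f]
      by simp
  qed
  moreover have "g (f S) \<in> ea_car D" for S
    using bool_hom_simps(1)[OF g] bhom_subset[OF f] by blast
  moreover have "g (f {1..m}) = ea_one D"
    using bool_hom_simps(2)[OF g] bhom_top[OF f] by simp
  ultimately show ?thesis
    by (auto simp: ea_hom_def boolEA_def split: if_splits)
qed

section \<open>Coordinates of atoms and rectangles in the coproduct of Boolean algebras\<close>

definition dec1 :: "nat \<Rightarrow> nat \<Rightarrow> nat" where "dec1 n2 e = (e - 1) div n2 + 1"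
definition dec2 :: "nat \<Rightarrow> nat \<Rightarrow> nat" where "dec2 n2 e = (e - 1) mod n2 + 1"

lemma dec_enc:
  assumes "a \<ge> 1" "b \<in> {1..n2}"
  shows "dec1 n2 (enc n2 a b) = a" "dec2 n2 (enc n2 a b) = b"
proof -
  \<comment> \<open>In zero-based coordinates the code minus one is \<open>a' * n2 + b'\<close> with
    \<open>b' < n2\<close>, so division with remainder recovers both.\<close>
  obtain a' b' where "a = Suc a'" "b = Suc b'" "b' < n2"
    using assms by (cases a; cases b) auto
  then show "dec1 n2 (enc n2 a b) = a" "dec2 n2 (enc n2 a b) = b"
    by (auto simp: dec1_def dec2_def enc_def)
qed

lemma enc_closed:
  assumes "a \<in> {1..n1}" "b \<in> {1..n2}"
  shows "enc n2 a b \<in> {1..n1 * n2}"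
proof -
  have "(a - 1) * n2 + n2 = a * n2"
    using assms by (cases a) auto
  also have "\<dots> \<le> n1 * n2"
    using assms by (intro mult_right_mono) auto
  finally show ?thesis
    using assms by (auto simp: enc_def)
qed

lemma dec_closed:
  assumes "e \<in> {1..n1 * n2}"
  shows "dec1 n2 e \<in> {1..n1}" "dec2 n2 e \<in> {1..n2}" "enc n2 (dec1 n2 e) (dec2 n2 e) = e"
proof -
  have "n2 > 0" "e - 1 < n1 * n2" "e \<ge> 1"
    using assms by (auto intro!: Nat.gr0I)
  then have "(e - 1) div n2 < n1" "(e - 1) mod n2 < n2"
    by (auto simp: less_mult_imp_div_less)
  then show "dec1 n2 e \<in> {1..n1}" "dec2 n2 e \<in> {1..n2}"
    by (auto simp: dec1_def dec2_def)
  show "enc n2 (dec1 n2 e) (dec2 n2 e) = e"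
    using \<open>e \<ge> 1\<close> by (simp add: enc_def dec1_def dec2_def flip: add.assoc)
qed

text \<open>Coordinates of an atom are unique, so the cylinders over \<open>U\<close> and
  \<open>V\<close> meet in a rectangle. These rectangles are the pure tensors of
  \<open>2^[n1] * 2^[n2]\<close>.\<close>

lemma inj1_Int_inj2:
  assumes "U \<subseteq> {1..n1}" "V \<subseteq> {1..n2}"
  shows "inj1 n1 n2 U \<inter> inj2 n1 n2 V = (\<lambda>(a, b). enc n2 a b) ` (U \<times> V)"
proof
  show "inj1 n1 n2 U \<inter> inj2 n1 n2 V \<subseteq> (\<lambda>(a, b). enc n2 a b) ` (U \<times> V)"
  proof
    fix e assume "e \<in> inj1 n1 n2 U \<inter> inj2 n1 n2 V"
    then have *: "e \<in> inj1 n1 n2 U" "e \<in> inj2 n1 n2 V" by auto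
    obtain a b where e: "e = enc n2 a b" "a \<in> U" "b \<in> {1..n2}"
      using *(1) assms by (auto simp: inj1_def)
    obtain a' b' where e': "e = enc n2 a' b'" "a' \<in> {1..n1}" "b' \<in> V"
      using *(2) assms by (auto simp: inj2_def)
    have "a \<ge> 1" "b' \<in> {1..n2}"
      using assms e e' by auto
    then have "b = b'"
      using dec_enc[of a b n2] dec_enc[of a' b' n2] e e' by simp
    with e e' show "e \<in> (\<lambda>(a, b). enc n2 a b) ` (U \<times> V)" by auto
  qed
next
  show "(\<lambda>(a, b). enc n2 a b) ` (U \<times> V) \<subseteq> inj1 n1 n2 U \<inter> inj2 n1 n2 V"
  proof (clarify, intro IntI)
    fix a b assume "a \<in> U" "b \<in> V"
    moreover from this have "a \<in> {1..n1}" "b \<in> {1..n2}" using assms by auto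
    ultimately show "enc n2 a b \<in> inj1 n1 n2 U" "enc n2 a b \<in> inj2 n1 n2 V"
      using assms unfolding inj1_def inj2_def by (simp, blast)+
  qed
qed

lemma mem_inj1_Int_inj2:
  assumes "U \<subseteq> {1..n1}" "V \<subseteq> {1..n2}"
  shows "e \<in> inj1 n1 n2 U \<inter> inj2 n1 n2 V \<longleftrightarrow>
    e \<in> {1..n1 * n2} \<and> dec1 n2 e \<in> U \<and> dec2 n2 e \<in> V"
proof
  assume "e \<in> inj1 n1 n2 U \<inter> inj2 n1 n2 V"
  then obtain a b where "e = enc n2 a b" "a \<in> U" "b \<in> V"
    unfolding inj1_Int_inj2[OF assms] by auto
  moreover from this have "a \<in> {1..n1}" "b \<in> {1..n2}" using assms by auto
  ultimately show "e \<in> {1..n1 * n2} \<and> dec1 n2 e \<in> U \<and> dec2 n2 e \<in> V"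
    using dec_enc[of a b n2] enc_closed[of a n1 b n2] by simp
next
  assume e: "e \<in> {1..n1 * n2} \<and> dec1 n2 e \<in> U \<and> dec2 n2 e \<in> V"
  then have "(\<lambda>(a, b). enc n2 a b) (dec1 n2 e, dec2 n2 e) = e"
    using dec_closed(3)[of e n1 n2] by simp
  with e show "e \<in> inj1 n1 n2 U \<inter> inj2 n1 n2 V"
    unfolding inj1_Int_inj2[OF assms] by (metis SigmaI imageI)
qed

lemma inj1_Int_inj2_Collect:
  assumes "U \<subseteq> {1..n1}" "V \<subseteq> {1..n2}"
  shows "inj1 n1 n2 U \<inter> inj2 n1 n2 V = {e \<in> {1..n1 * n2}. dec1 n2 e \<in> U \<and> dec2 n2 e \<in> V}"
  unfolding set_eq_iff mem_inj1_Int_inj2[OF assms] by simp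

text \<open>Under duality the coproduct of two homomorphisms corresponds to the product function
  \<open>p \<times> q\<close>, written here in encoded coordinates.\<close>

lemma cmap_preim:
  assumes p: "p ` {1..d1} \<subseteq> {1..n1}" and q: "q ` {1..d2} \<subseteq> {1..n2}"
  shows "cmap n1 n2 d1 d2 (preim n1 d1 p) (preim n2 d2 q) =
    preim (n1 * n2) (d1 * d2) (\<lambda>e. enc n2 (p (dec1 d2 e)) (q (dec2 d2 e)))"
    (is "?g = preim _ _ ?r")
proof
  fix S
  show "?g S = preim (n1 * n2) (d1 * d2) ?r S"
  proof (cases "S \<in> Pow {1..n1 * n2}")
    case True
    have sub: "preim n1 d1 p X \<subseteq> {1..d1}" "preim n2 d2 q X \<subseteq> {1..d2}" for X
      by (auto simp: preim_def)
    have "e \<in> ?g S \<longleftrightarrow> (\<exists>a\<in>{1..n1}. \<exists>b\<in>{1..n2}. enc n2 a b \<in> S \<and>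
        e \<in> inj1 d1 d2 (preim n1 d1 p {a}) \<inter> inj2 d1 d2 (preim n2 d2 q {b}))" for e
      unfolding cmap_def if_P[OF True] Union_iff Bex_def mem_Collect_eq by blast
    \<comment> \<open>Only one rectangle in the union can contain \<open>e\<close>: the one indexed
      by the images under \<open>p\<close> and \<open>q\<close> of the coordinates of
      \<open>e\<close>.\<close>
    also have "\<dots> e \<longleftrightarrow> e \<in> {1..d1 * d2} \<and> ?r e \<in> S" for e
    proof (cases "e \<in> {1..d1 * d2}")
      case True
      then have "dec1 d2 e \<in> {1..d1}" "dec2 d2 e \<in> {1..d2}"
        using dec_closed by blast+
      moreover from this have "p (dec1 d2 e) \<in> {1..n1}" "q (dec2 d2 e) \<in> {1..n2}"
        using p q by blast+
      ultimately show ?thesis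
        unfolding mem_inj1_Int_inj2[OF sub] using True by (auto simp: preim_def)
    next
      case False
      then show ?thesis
        unfolding mem_inj1_Int_inj2[OF sub] by blast
    qed
    finally show ?thesis
      using True by (auto simp: preim_def)
  qed (auto simp: cmap_def preim_def)
qed

text \<open>Dualising both factors reduces the homomorphism laws to those of a preimage map; it
  remains that the product function lands in \<open>[n1 * n2]\<close>.\<close>

lemma bhom_cmap:
  assumes "bhom n1 d1 g1" "bhom n2 d2 g2"
  shows "bhom (n1 * n2) (d1 * d2) (cmap n1 n2 d1 d2 g1 g2)"
proof -
  obtain p q where p: "p ` {1..d1} \<subseteq> {1..n1}" "g1 = preim n1 d1 p"
    and q: "q ` {1..d2} \<subseteq> {1..n2}" "g2 = preim n2 d2 q"
    using bhom_eq_preim assms by metis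
  have "(\<lambda>e. enc n2 (p (dec1 d2 e)) (q (dec2 d2 e))) ` {1..d1 * d2} \<subseteq> {1..n1 * n2}"
  proof (rule image_subsetI)
    fix e assume "e \<in> {1..d1 * d2}"
    then have "dec1 d2 e \<in> {1..d1}" "dec2 d2 e \<in> {1..d2}"
      using dec_closed by blast+
    then have "p (dec1 d2 e) \<in> {1..n1}" "q (dec2 d2 e) \<in> {1..n2}"
      using p q by blast+
    then show "enc n2 (p (dec1 d2 e)) (q (dec2 d2 e)) \<in> {1..n1 * n2}"
      by (rule enc_closed)
  qed
  then show ?thesis
    using p q cmap_preim bhom_preim by metis
qed

text \<open>\<open>enc\<close> is injective on valid coordinates, so the union in
  \<open>cmap\<close> has a single term.\<close>

lemma cmap_atom:
  assumes "a \<in> {1..n1}" "b \<in> {1..n2}"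
  shows "cmap n1 n2 d1 d2 g1 g2 {enc n2 a b} = inj1 d1 d2 (g1 {a}) \<inter> inj2 d1 d2 (g2 {b})"
proof -
  have "a' = a \<and> b' = b" if "a' \<in> {1..n1}" "b' \<in> {1..n2}" "enc n2 a' b' = enc n2 a b" for a' b'
    using that assms dec_enc[of a b n2] dec_enc[of a' b' n2] by auto
  then have "{inj1 d1 d2 (g1 {a'}) \<inter> inj2 d1 d2 (g2 {b'}) | a' b'.
      a' \<in> {1..n1} \<and> b' \<in> {1..n2} \<and> enc n2 a' b' \<in> {enc n2 a b}}
    = {inj1 d1 d2 (g1 {a}) \<inter> inj2 d1 d2 (g2 {b})}"
    using assms by blast
  moreover have "enc n2 a b \<in> {1..n1 * n2}"
    using assms by (rule enc_closed)
  ultimately show ?thesis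
    unfolding cmap_def by simp
qed

section \<open>From bimorphisms to cocones\<close>

lemma RR_hom: "x \<in> pob (RR A) n \<Longrightarrow> ea_hom (boolEA n) A x"
  by (simp add: RR_def)

lemma RR_pmap_apply: "S \<subseteq> {1..m} \<Longrightarrow> pmap (RR A) m n g x S = x (g S)"
  by (simp add: RR_def)

lemma RR_pmap_closed:
  assumes g: "bhom m n g" and x: "x \<in> pob (RR A) n"
  shows "pmap (RR A) m n g x \<in> pob (RR A) m"
proof -
  have "ea_hom (boolEA m) A (x \<circ> g)"
    using ea_hom_comp_bhom[OF g RR_hom[OF x]] .
  then show ?thesis
    by (auto simp: RR_def ea_hom_def boolEA_def split: if_splits)
qed

text \<open>The morphism out of \<open>2^[n1] * 2^[n2]\<close> induced by the bimorphism
  \<open>k (x U) (y V)\<close>, given by its tuple of values on atoms.\<close>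

definition tensor_hom ::
  "'d ea \<Rightarrow> ('a \<Rightarrow> 'b \<Rightarrow> 'd) \<Rightarrow> nat \<Rightarrow> nat \<Rightarrow> (nat set \<Rightarrow> 'a) \<Rightarrow> (nat set \<Rightarrow> 'b) \<Rightarrow> nat set \<Rightarrow> 'd" where
  "tensor_hom D k n1 n2 x y =
     effect_algebra.tuple_hom D (n1 * n2) (\<lambda>e. k (x {dec1 n2 e}) (y {dec2 n2 e}))"

lemma bimorph_left_add:
  "bimorph A B D k \<Longrightarrow> a1 \<in> ea_car A \<Longrightarrow> a2 \<in> ea_car A \<Longrightarrow> b \<in> ea_car B \<Longrightarrow>
    ea_sum A a1 a2 = Some a \<Longrightarrow> ea_sum D (k a1 b) (k a2 b) = Some (k a b)"
  and bimorph_right_add: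
  "bimorph A B D k \<Longrightarrow> a \<in> ea_car A \<Longrightarrow> b1 \<in> ea_car B \<Longrightarrow> b2 \<in> ea_car B \<Longrightarrow>
    ea_sum B b1 b2 = Some b \<Longrightarrow> ea_sum D (k a b1) (k a b2) = Some (k a b)"
  by (simp_all add: bimorph_def)

text \<open>Sum over a rectangle row by row: additivity of \<open>k\<close> in the second argument
  collapses each row, additivity in the first collapses the resulting column.\<close>

lemma (in effect_algebra) tensor_hom:
  assumes k: "bimorph A B D k"
    and x: "ea_hom (boolEA n1) A x" and y: "ea_hom (boolEA n2) B y"
  shows "ea_hom (boolEA (n1 * n2)) D (tensor_hom D k n1 n2 x y)"
    and "U \<subseteq> {1..n1} \<Longrightarrow> V \<subseteq> {1..n2} \<Longrightarrow>
      tensor_hom D k n1 n2 x y (inj1 n1 n2 U \<inter> inj2 n1 n2 V) = k (x U) (y V)"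
proof -
  let ?g = "\<lambda>e. k (x {dec1 n2 e}) (y {dec2 n2 e})"
  have car: "k (x U) (y V) \<in> ea_car D" if "U \<subseteq> {1..n1}" "V \<subseteq> {1..n2}" for U V
    using k bool_hom_simps(1)[OF x that(1)] bool_hom_simps(1)[OF y that(2)]
    by (simp add: bimorph_def)
  have box: "esum (\<lambda>e. Some (?g e)) (inj1 n1 n2 U \<inter> inj2 n1 n2 V) = Some (k (x U) (y V))"
    if U: "U \<subseteq> {1..n1}" and V: "V \<subseteq> {1..n2}" for U V
  proof -
    have *: "dec1 n2 (enc n2 a b) = a" "dec2 n2 (enc n2 a b) = b" if "a \<in> U" "b \<in> V" for a b
    proof -
      have "a \<in> {1..n1}" "b \<in> {1..n2}" using that U V by auto
      then show "dec1 n2 (enc n2 a b) = a" "dec2 n2 (enc n2 a b) = b"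
        using dec_enc[of a b n2] by simp_all
    qed
    have "inj_on (\<lambda>(a, b). enc n2 a b) (U \<times> V)"
      by (rule inj_on_inverseI[where g="\<lambda>e. (dec1 n2 e, dec2 n2 e)"]) (auto simp: *)
    then have "esum (\<lambda>e. Some (?g e)) (inj1 n1 n2 U \<inter> inj2 n1 n2 V)
        = esum (\<lambda>(a, b). Some (k (x {a}) (y {b}))) (U \<times> V)"
      unfolding inj1_Int_inj2[OF U V]
      by (subst esum.reindex) (auto simp: * intro!: esum.cong)
    also have "\<dots> = esum (\<lambda>a. esum (\<lambda>b. Some (k (x {a}) (y {b}))) V) U"
      by (rule esum.cartesian_product[symmetric])
    also have "\<dots> = esum (\<lambda>a. Some (k (x {a}) (y V))) U"
    proof (rule esum.cong[OF refl])
      fix a assume "a \<in> U"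
      then have a: "{a} \<subseteq> {1..n1}" using U by auto
      show "esum (\<lambda>b. Some (k (x {a}) (y {b}))) V = Some (k (x {a}) (y V))"
      proof (rule additive_esum[where g="\<lambda>V. k (x {a}) (y V)" and I="{1..n2}"])
        fix X Y assume XY: "X \<in> Pow {1..n2}" "Y \<in> Pow {1..n2}" "X \<inter> Y = {}"
        then show "ea_sum D (k (x {a}) (y X)) (k (x {a}) (y Y)) = Some (k (x {a}) (y (X \<union> Y)))"
          by (intro bimorph_right_add[OF k] bool_hom_simps[OF x] bool_hom_simps[OF y] a PowD)
      qed (use V car a finite_subset[OF V] in auto)
    qed
    also have "\<dots> = Some (k (x U) (y V))"
    proof (rule additive_esum[where g="\<lambda>U. k (x U) (y V)" and I="{1..n1}"])
      fix X Y assume XY: "X \<in> Pow {1..n1}" "Y \<in> Pow {1..n1}" "X \<inter> Y = {}"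
      then show "ea_sum D (k (x X) (y V)) (k (x Y) (y V)) = Some (k (x (X \<union> Y)) (y V))"
        by (intro bimorph_left_add[OF k] bool_hom_simps[OF x] bool_hom_simps[OF y] V PowD)
    qed (use U V car finite_subset[OF U] in auto)
    finally show ?thesis .
  qed
  \<comment> \<open>The full set is itself a rectangle, so the tuple of atoms sums to
    \<open>k 1 1 = 1\<close>, as \<open>tuple_hom\<close> requires.\<close>
  have full: "inj1 n1 n2 {1..n1} \<inter> inj2 n1 n2 {1..n2} = {1..n1 * n2}"
    using mem_inj1_Int_inj2[of "{1..n1}" n1 "{1..n2}" n2] dec_closed by blast
  have "?g e \<in> ea_car D" if "e \<in> {1..n1 * n2}" for e
    using car[of "{dec1 n2 e}" "{dec2 n2 e}"] dec_closed[OF that] by simp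
  note th = tuple_hom[where n="n1 * n2" and f="?g", OF this]
  have one: "esum (\<lambda>e. Some (?g e)) {1..n1 * n2} = Some (ea_one D)"
    using box[of "{1..n1}" "{1..n2}"] k bool_hom_simps(2)[OF x] bool_hom_simps(2)[OF y]
    unfolding full by (simp add: bimorph_def)
  show "ea_hom (boolEA (n1 * n2)) D (tensor_hom D k n1 n2 x y)"
    unfolding tensor_hom_def using th(1) one by blast
  assume U: "U \<subseteq> {1..n1}" and V: "V \<subseteq> {1..n2}"
  then have "inj1 n1 n2 U \<inter> inj2 n1 n2 V \<subseteq> {1..n1 * n2}"
    using mem_inj1_Int_inj2 by blast
  then have "esum (\<lambda>e. Some (?g e)) (inj1 n1 n2 U \<inter> inj2 n1 n2 V) =
      Some (tensor_hom D k n1 n2 x y (inj1 n1 n2 U \<inter> inj2 n1 n2 V))"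
    unfolding tensor_hom_def using th(2) one by blast
  then show "tensor_hom D k n1 n2 x y (inj1 n1 n2 U \<inter> inj2 n1 n2 V) = k (x U) (y V)"
    using box[OF U V] by simp
qed

lemma inj1_Int_inj2_atom:
  assumes "a \<in> {1..n1}" "b \<in> {1..n2}"
  shows "inj1 n1 n2 {a} \<inter> inj2 n1 n2 {b} = {enc n2 a b}"
  using inj1_Int_inj2[of "{a}" n1 "{b}" n2] assms by auto

lemma (in effect_algebra) bool_prod_hom_eqI:
  assumes "ea_hom (boolEA (n1 * n2)) D g" "ea_hom (boolEA (n1 * n2)) D g'"
    and "\<And>a b. a \<in> {1..n1} \<Longrightarrow> b \<in> {1..n2} \<Longrightarrow> g {enc n2 a b} = g' {enc n2 a b}"
    and "S \<subseteq> {1..n1 * n2}"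
  shows "g S = g' S"
  using assms(1,2) _ assms(4)
proof (rule bool_hom_eqI)
  fix e assume "e \<in> {1..n1 * n2}"
  then show "g {e} = g' {e}"
    using assms(3)[of "dec1 n2 e" "dec2 n2 e"] dec_closed[of e n1 n2] by simp
qed

text \<open>Dinaturality, the condition for descending to the coend. Both sides are morphisms, so
  atoms suffice; as \<open>cmap\<close> sends an atom to a rectangle, both values there are
  \<open>k (x (g1 {a})) (y (g2 {b}))\<close>.\<close>

lemma (in effect_algebra) tensor_hom_cmap:
  assumes k: "bimorph A B D k" and g1: "bhom n1 d1 g1" and g2: "bhom n2 d2 g2"
    and x: "x \<in> pob (RR A) d1" and y: "y \<in> pob (RR B) d2" and S: "S \<subseteq> {1..n1 * n2}"
  shows "tensor_hom D k d1 d2 x y (cmap n1 n2 d1 d2 g1 g2 S) =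
    tensor_hom D k n1 n2 (pmap (RR A) n1 d1 g1 x) (pmap (RR B) n2 d2 g2 y) S"
proof -
  note x' = RR_hom[OF RR_pmap_closed[OF g1 x]] and y' = RR_hom[OF RR_pmap_closed[OF g2 y]]
  note xy = tensor_hom[OF k RR_hom[OF x] RR_hom[OF y]] and xy' = tensor_hom[OF k x' y']
  have "(tensor_hom D k d1 d2 x y \<circ> cmap n1 n2 d1 d2 g1 g2) S =
    tensor_hom D k n1 n2 (pmap (RR A) n1 d1 g1 x) (pmap (RR B) n2 d2 g2 y) S"
  proof (rule bool_prod_hom_eqI[OF _ xy'(1) _ S])
    show "ea_hom (boolEA (n1 * n2)) D (tensor_hom D k d1 d2 x y \<circ> cmap n1 n2 d1 d2 g1 g2)"
      using ea_hom_comp_bhom[OF bhom_cmap[OF g1 g2] xy(1)] .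
    fix a b assume ab: "a \<in> {1..n1}" "b \<in> {1..n2}"
    then have "{a} \<subseteq> {1..n1}" "{b} \<subseteq> {1..n2}" by auto
    then have "tensor_hom D k n1 n2 (pmap (RR A) n1 d1 g1 x) (pmap (RR B) n2 d2 g2 y) {enc n2 a b}
        = k (x (g1 {a})) (y (g2 {b}))"
      using xy'(2)[of "{a}" "{b}"] by (simp only: inj1_Int_inj2_atom[OF ab] RR_pmap_apply)
    moreover have "tensor_hom D k d1 d2 x y (cmap n1 n2 d1 d2 g1 g2 {enc n2 a b})
        = k (x (g1 {a})) (y (g2 {b}))"
      using xy(2)[of "g1 {a}" "g2 {b}"] bhom_subset[OF g1] bhom_subset[OF g2]
      by (simp only: cmap_atom[OF ab])
    ultimately show "(tensor_hom D k d1 d2 x y \<circ> cmap n1 n2 d1 d2 g1 g2) {enc n2 a b} =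
      tensor_hom D k n1 n2 (pmap (RR A) n1 d1 g1 x) (pmap (RR B) n2 d2 g2 y) {enc n2 a b}"
      by simp
  qed
  then show ?thesis by simp
qed

section \<open>Equivalence classes in the Day convolution and their restriction maps\<close>

definition day_class :: "'x psh \<Rightarrow> 'y psh \<Rightarrow> nat \<Rightarrow> ('x, 'y) dtuple \<Rightarrow> ('x, 'y) dtuple set" where
  "day_class X Y n t = day_rel X Y n `` {t}"

lemma day_rel_refl: "(t, t) \<in> day_rel X Y n"
  by (simp add: day_rel_def)

lemma day_rel_sym: "(s, t) \<in> day_rel X Y n \<Longrightarrow> (t, s) \<in> day_rel X Y n"
  unfolding day_rel_def by (meson sym_Un_converse sym_rtrancl symD)

lemma day_rel_trans:
  "(s, t) \<in> day_rel X Y n \<Longrightarrow> (t, u) \<in> day_rel X Y n \<Longrightarrow> (s, u) \<in> day_rel X Y n"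
  unfolding day_rel_def by (rule rtrancl_trans)

lemma day_class_eqI: "(s, t) \<in> day_rel X Y n \<Longrightarrow> day_class X Y n s = day_class X Y n t"
  unfolding day_class_def by (blast intro: day_rel_trans day_rel_sym)

lemma day_stepI:
  assumes "bhom n1 d1 g1" "bhom n2 d2 g2" "bhom n (n1 * n2) f" "x \<in> pob X d1" "y \<in> pob Y d2"
  shows "((d1, d2, cmap n1 n2 d1 d2 g1 g2 \<circ> f, x, y), (n1, n2, f, pmap X n1 d1 g1 x, pmap Y n2 d2 g2 y))
    \<in> day_step X Y n"
  unfolding day_step_def using assms by blast

lemma day_stepE:
  assumes "(s, t) \<in> day_step X Y n"
  obtains n1 n2 d1 d2 g1 g2 f x y where "s = (d1, d2, cmap n1 n2 d1 d2 g1 g2 \<circ> f, x, y)"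
    "t = (n1, n2, f, pmap X n1 d1 g1 x, pmap Y n2 d2 g2 y)"
    "bhom n1 d1 g1" "bhom n2 d2 g2" "bhom n (n1 * n2) f" "x \<in> pob X d1" "y \<in> pob Y d2"
  using assms unfolding day_step_def by blast

lemma day_class_step: "(s, t) \<in> day_step X Y n \<Longrightarrow> day_class X Y n s = day_class X Y n t"
  by (rule day_class_eqI) (auto simp: day_rel_def)

lemma day_class_in_Day:
  assumes "bhom n (n1 * n2) f" "x \<in> pob X n1" "y \<in> pob Y n2"
  shows "day_class X Y n (n1, n2, f, x, y) \<in> pob (Day X Y) n"
  using assms by (auto simp: Day_def day_class_def day_dom_def intro!: quotientI)

lemma in_DayE:
  assumes "c \<in> pob (Day X Y) n"
  obtains n1 n2 f x y where "c = day_class X Y n (n1, n2, f, x, y)"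
    "bhom n (n1 * n2) f" "x \<in> pob X n1" "y \<in> pob Y n2"
proof -
  have "c \<in> day_dom X Y n // day_rel X Y n"
    using assms by (simp add: Day_def)
  then obtain t where "t \<in> day_dom X Y n" "c = day_rel X Y n `` {t}"
    by (rule quotientE)
  then show ?thesis
    using that by (auto simp: day_dom_def day_class_def)
qed

definition day_precomp :: "(nat set \<Rightarrow> nat set) \<Rightarrow> ('x, 'y) dtuple \<Rightarrow> ('x, 'y) dtuple" where
  "day_precomp h = (\<lambda>(n1, n2, f, x, y). (n1, n2, f \<circ> h, x, y))"

text \<open>A step composes \<open>cmap\<close> after \<open>f\<close>, restriction composes
  \<open>h\<close> before it, so the two commute by associativity.\<close>

lemma day_step_precomp:
  assumes h: "bhom m n h" and st: "(s, t) \<in> day_step X Y n"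
  shows "(day_precomp h s, day_precomp h t) \<in> day_step X Y m"
  using st
proof (rule day_stepE)
  fix n1 n2 d1 d2 g1 g2 f x y
  assume st: "s = (d1, d2, cmap n1 n2 d1 d2 g1 g2 \<circ> f, x, y)"
      "t = (n1, n2, f, pmap X n1 d1 g1 x, pmap Y n2 d2 g2 y)"
    and prems: "bhom n1 d1 g1" "bhom n2 d2 g2" and f: "bhom n (n1 * n2) f"
    and xy: "x \<in> pob X d1" "y \<in> pob Y d2"
  show ?thesis
    using day_stepI[OF prems bhom_comp[OF h f] xy] unfolding st day_precomp_def by (simp add: comp_assoc)
qed

lemma day_rel_precomp:
  assumes h: "bhom m n h" and st: "(s, t) \<in> day_rel X Y n"
  shows "(day_precomp h s, day_precomp h t) \<in> day_rel X Y m"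
  using st unfolding day_rel_def
proof induction
  case (step t u)
  then have "(day_precomp h t, day_precomp h u) \<in> day_step X Y m \<union> (day_step X Y m)\<inverse>"
    using day_step_precomp[OF h] by blast
  with step.IH show ?case by (rule rtrancl_into_rtrancl)
qed simp

text \<open>Restriction respects the relation, so all representatives yield the same class; the
  image under \<open>the_elem\<close> is a singleton.\<close>

lemma pmap_Day:
  assumes h: "bhom m n h"
  shows "pmap (Day X Y) m n h (day_class X Y n (n1, n2, f, x, y)) =
    day_class X Y m (n1, n2, f \<circ> h, x, y)"
proof -
  let ?t = "(n1, n2, f, x, y)"
  have "(\<lambda>s. day_class X Y m (day_precomp h s)) ` day_class X Y n ?t
      = {day_class X Y m (day_precomp h ?t)}"
  proof -
    have "day_class X Y m (day_precomp h s) = day_class X Y m (day_precomp h ?t)"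
      if "s \<in> day_class X Y n ?t" for s
    proof -
      have "(?t, s) \<in> day_rel X Y n"
        using that by (simp add: day_class_def)
      then show ?thesis
        using day_class_eqI[OF day_rel_precomp[OF h]] by metis
    qed
    moreover have "?t \<in> day_class X Y n ?t"
      by (simp add: day_class_def day_rel_refl)
    ultimately show ?thesis by blast
  qed
  moreover have *: "(\<lambda>s. day_class X Y m (day_precomp h s)) =
      (\<lambda>(n1, n2, f, x, y). day_rel X Y m `` {(n1, n2, f \<circ> h, x, y)})"
    by (auto simp: day_class_def day_precomp_def)
  moreover have "pmap (Day X Y) m n h (day_class X Y n ?t) =
      the_elem ((\<lambda>s. day_class X Y m (day_precomp h s)) ` day_class X Y n ?t)"
    unfolding * by (simp add: Day_def)
  ultimately show ?thesis
    by (simp add: day_precomp_def)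
qed

definition day_val :: "'d ea \<Rightarrow> ('a \<Rightarrow> 'b \<Rightarrow> 'd) \<Rightarrow>
    (nat set \<Rightarrow> 'a, nat set \<Rightarrow> 'b) dtuple \<Rightarrow> nat set \<Rightarrow> 'd" where
  "day_val D k = (\<lambda>(n1, n2, f, x, y) S. tensor_hom D k n1 n2 x y (f S))"

text \<open>An arbitrary \<open>S\<close> is allowed because \<open>f S\<close> lies in
  \<open>[n1 * n2]\<close> even off the domain of \<open>f\<close>, where it is
  \<open>{}\<close>.\<close>

lemma (in effect_algebra) day_val_step:
  assumes k: "bimorph A B D k" and "(s, t) \<in> day_step (RR A) (RR B) n"
  shows "day_val D k s S = day_val D k t S"
  using assms(2)
  by (rule day_stepE) (simp add: day_val_def tensor_hom_cmap[OF k] bhom_subset del: One_nat_def)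

lemma (in effect_algebra) day_val_rel:
  assumes k: "bimorph A B D k" and "(s, t) \<in> day_rel (RR A) (RR B) n"
  shows "day_val D k s S = day_val D k t S"
  using assms(2) unfolding day_rel_def
proof induction
  case (step t u)
  then have "(t, u) \<in> day_step (RR A) (RR B) n \<or> (u, t) \<in> day_step (RR A) (RR B) n" by blast
  then have "day_val D k t S = day_val D k u S"
    using day_val_step[OF k, of t u n S] day_val_step[OF k, of u t n S] by argo
  with step.IH show ?case by simp
qed simp

definition bimorph_cocone :: "'d ea \<Rightarrow> ('a \<Rightarrow> 'b \<Rightarrow> 'd) \<Rightarrow>
    nat \<Rightarrow> (nat set \<Rightarrow> 'a, nat set \<Rightarrow> 'b) dtuple set \<Rightarrow> nat set \<Rightarrow> 'd" where
  "bimorph_cocone D k n c = day_val D k (SOME t. t \<in> c)"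

text \<open>Independence of the representative chosen by \<open>SOME\<close>: \<open>day_val\<close>
  is constant along \<open>day_rel\<close>.\<close>

lemma (in effect_algebra) bimorph_cocone_class:
  assumes k: "bimorph A B D k"
  shows "bimorph_cocone D k n (day_class (RR A) (RR B) n (n1, n2, f, x, y)) S =
    tensor_hom D k n1 n2 x y (f S)"
proof -
  let ?t = "(n1, n2, f, x, y)"
  let ?s = "SOME s. s \<in> day_class (RR A) (RR B) n ?t"
  have "?t \<in> day_class (RR A) (RR B) n ?t"
    by (simp add: day_class_def day_rel_refl)
  then have "?s \<in> day_class (RR A) (RR B) n ?t"
    by (rule someI)
  then have "day_val D k ?t S = day_val D k ?s S"
    using day_val_rel[OF k] by (simp add: day_class_def)
  then show ?thesis
    by (simp add: bimorph_cocone_def day_val_def)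
qed

text \<open>Each component is a \<open>tensor_hom\<close> composed with a Boolean homomorphism.
  Restriction only precomposes the latter, which gives compatibility.\<close>

lemma (in effect_algebra) cocone_bimorph_cocone:
  assumes k: "bimorph A B D k"
  shows "cocone (Day (RR A) (RR B)) D (bimorph_cocone D k)"
  unfolding cocone_def
proof (intro conjI allI impI ballI)
  fix n c assume "c \<in> pob (Day (RR A) (RR B)) n"
  then obtain n1 n2 f x y where c: "c = day_class (RR A) (RR B) n (n1, n2, f, x, y)"
    "bhom n (n1 * n2) f" "x \<in> pob (RR A) n1" "y \<in> pob (RR B) n2"
    by (rule in_DayE)
  have "ea_hom (boolEA n) D (tensor_hom D k n1 n2 x y \<circ> f)"
    using ea_hom_comp_bhom[OF c(2) tensor_hom(1)[OF k RR_hom[OF c(3)] RR_hom[OF c(4)]]] .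
  moreover have "bimorph_cocone D k n c = tensor_hom D k n1 n2 x y \<circ> f"
    using bimorph_cocone_class[OF k] c by auto
  ultimately show "ea_hom (boolEA n) D (bimorph_cocone D k n c)" by simp
next
  fix n n' c f S
  assume "c \<in> pob (Day (RR A) (RR B)) n' \<and> bhom n n' f"
  then show "bimorph_cocone D k n' c (f S) =
      bimorph_cocone D k n (pmap (Day (RR A) (RR B)) n n' f c) S"
    by (auto simp: pmap_Day bimorph_cocone_class[OF k] elim!: in_DayE)
qed

section \<open>From cocones to bimorphisms\<close>

text \<open>The identity of \<open>2^[n]\<close> in the extensional representation, with
  \<open>{}\<close> off the domain as \<open>bhom\<close> demands.\<close>

definition bool_id :: "nat \<Rightarrow> nat set \<Rightarrow> nat set" where
  "bool_id n S = (if S \<in> Pow {1..n} then S else {})"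

lemma bhom_bool_id: "bhom n n (bool_id n)"
  unfolding bhom_def bool_id_def by auto

lemma bool_id_comp:
  assumes "bhom m n f"
  shows "bool_id n \<circ> f = f"
  using bhom_subset[OF assms] by (simp add: fun_eq_iff bool_id_def)

lemma comp_bool_id:
  assumes "bhom m n f"
  shows "f \<circ> bool_id m = f"
  using bhom_outside[OF assms] bhom_empty[OF assms] by (simp add: fun_eq_iff bool_id_def)

text \<open>The component of \<open>phi\<close> at the image of \<open>(x, y)\<close> under the
  universal map from \<open>X(c1) \<times> Y(c2)\<close> to the Day convolution at
  \<open>c1 * c2\<close>.\<close>

definition pair_hom :: "'a ea \<Rightarrow> 'b ea \<Rightarrow>
    (nat \<Rightarrow> (nat set \<Rightarrow> 'a, nat set \<Rightarrow> 'b) dtuple set \<Rightarrow> nat set \<Rightarrow> 'd) \<Rightarrow>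
    nat \<Rightarrow> nat \<Rightarrow> (nat set \<Rightarrow> 'a) \<Rightarrow> (nat set \<Rightarrow> 'b) \<Rightarrow> nat set \<Rightarrow> 'd" where
  "pair_hom A B phi n1 n2 x y =
     phi (n1 * n2) (day_class (RR A) (RR B) (n1 * n2) (n1, n2, bool_id (n1 * n2), x, y))"

definition elem_hom :: "'a ea \<Rightarrow> 'a \<Rightarrow> nat set \<Rightarrow> 'a" where
  "elem_hom A a = (THE x. x \<in> pob (RR A) 2 \<and> x {1} = a)"

text \<open>The two elements sit at the atom \<open>{1}\<close> of their copies of
  \<open>2^[2]\<close>, so their pure tensor sits at the rectangle
  \<open>{1} \<times> {1}\<close>.\<close>

definition cocone_bimorph :: "'a ea \<Rightarrow> 'b ea \<Rightarrow>
    (nat \<Rightarrow> (nat set \<Rightarrow> 'a, nat set \<Rightarrow> 'b) dtuple set \<Rightarrow> nat set \<Rightarrow> 'd) \<Rightarrow> 'a \<Rightarrow> 'b \<Rightarrow> 'd" where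
  "cocone_bimorph A B phi a b =
     pair_hom A B phi 2 2 (elem_hom A a) (elem_hom B b) (inj1 2 2 {1} \<inter> inj2 2 2 {1})"

lemma elem_hom:
  assumes "effect_alg A" "a \<in> ea_car A"
  shows "elem_hom A a \<in> pob (RR A) 2" "elem_hom A a {1} = a"
proof -
  note the = theI'[OF effect_algebra.ex1_RR_2[OF effect_algebra.intro[OF assms(1)] assms(2)]]
  show "elem_hom A a \<in> pob (RR A) 2" "elem_hom A a {1} = a"
    unfolding elem_hom_def using the[THEN conjunct1] the[THEN conjunct2] .
qed

text \<open>The map \<open>g\<close> is dual to the indicator function of \<open>U\<close>. Pulling
  \<open>x\<close> back along it gives a morphism from \<open>2^[2]\<close> with value
  \<open>x U\<close> at \<open>{1}\<close>, and \<open>ex1_RR_2\<close> identifies it.\<close>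

lemma elem_hom_eq:
  assumes "effect_alg A" "x \<in> pob (RR A) n" "U \<subseteq> {1..n}"
  obtains g where "bhom 2 n g" "g {1} = U" "pmap (RR A) 2 n g x = elem_hom A (x U)"
proof -
  let ?p = "\<lambda>j. if j \<in> U then 1 else 2 :: nat"
  let ?g = "preim 2 n ?p"
  have g: "bhom 2 n ?g"
    by (rule bhom_preim) auto
  have g1: "?g {1} = U"
    using assms(3) by (auto simp: preim_def)
  have 1: "{1} \<subseteq> {1..2::nat}" by auto
  have x: "x U \<in> ea_car A"
    using bool_hom_simps(1)[OF RR_hom[OF assms(2)] assms(3)] .
  have "pmap (RR A) 2 n ?g x {1} = x U"
    unfolding RR_pmap_apply[OF 1] g1 ..
  moreover have "pmap (RR A) 2 n ?g x \<in> pob (RR A) 2"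
    using RR_pmap_closed[OF g assms(2)] .
  ultimately have "elem_hom A (x U) = pmap (RR A) 2 n ?g x"
    unfolding elem_hom_def
    by (intro the1_equality conjI effect_algebra.ex1_RR_2 effect_algebra.intro assms(1) x)
  from that[OF g g1 this[symmetric]] show ?thesis .
qed

lemma cocone_hom: "cocone P D phi \<Longrightarrow> x \<in> pob P n \<Longrightarrow> ea_hom (boolEA n) D (phi n x)"
  and cocone_compat: "cocone P D phi \<Longrightarrow> x \<in> pob P n \<Longrightarrow> bhom m n f \<Longrightarrow> S \<subseteq> {1..m} \<Longrightarrow>
    phi n x (f S) = phi m (pmap P m n f x) S"
  by (simp_all add: cocone_def)

context
  fixes A :: "'a ea" and B :: "'b ea" and D :: "'d ea"
    and phi :: "nat \<Rightarrow> (nat set \<Rightarrow> 'a, nat set \<Rightarrow> 'b) dtuple set \<Rightarrow> nat set \<Rightarrow> 'd"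
  assumes A: "effect_alg A" and B: "effect_alg B"
    and phi: "cocone (Day (RR A) (RR B)) D phi"
begin

text \<open>Every class is the restriction along \<open>f\<close> of the class with the identity in
  place of \<open>f\<close>, so a cocone is determined by \<open>pair_hom\<close>.\<close>

lemma cocone_class:
  assumes "bhom n (n1 * n2) f" "x \<in> pob (RR A) n1" "y \<in> pob (RR B) n2" "S \<subseteq> {1..n}"
  shows "phi n (day_class (RR A) (RR B) n (n1, n2, f, x, y)) S =
    pair_hom A B phi n1 n2 x y (f S)"
proof -
  have "day_class (RR A) (RR B) (n1 * n2) (n1, n2, bool_id (n1 * n2), x, y)
      \<in> pob (Day (RR A) (RR B)) (n1 * n2)"
    using assms bhom_bool_id by (intro day_class_in_Day)
  from cocone_compat[OF phi this assms(1,4)] have "pair_hom A B phi n1 n2 x y (f S) = phi n (pmap (Day (RR A) (RR B)) n (n1 * n2) f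
      (day_class (RR A) (RR B) (n1 * n2) (n1, n2, bool_id (n1 * n2), x, y))) S"
    unfolding pair_hom_def .
  then show ?thesis
    by (simp add: pmap_Day[OF assms(1)] bool_id_comp[OF assms(1)])
qed

lemma ea_hom_pair_hom:
  assumes "x \<in> pob (RR A) n1" "y \<in> pob (RR B) n2"
  shows "ea_hom (boolEA (n1 * n2)) D (pair_hom A B phi n1 n2 x y)"
proof -
  have "day_class (RR A) (RR B) (n1 * n2) (n1, n2, bool_id (n1 * n2), x, y)
      \<in> pob (Day (RR A) (RR B)) (n1 * n2)"
    using assms bhom_bool_id by (intro day_class_in_Day)
  then show ?thesis
    unfolding pair_hom_def by (rule cocone_hom[OF phi])
qed

lemma pair_hom_cmap:
  assumes g1: "bhom n1 d1 g1" and g2: "bhom n2 d2 g2"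
    and x: "x \<in> pob (RR A) d1" and y: "y \<in> pob (RR B) d2" and S: "S \<subseteq> {1..n1 * n2}"
  shows "pair_hom A B phi d1 d2 x y (cmap n1 n2 d1 d2 g1 g2 S) =
    pair_hom A B phi n1 n2 (pmap (RR A) n1 d1 g1 x) (pmap (RR B) n2 d2 g2 y) S"
proof -
  let ?c = "cmap n1 n2 d1 d2 g1 g2" and ?i = "bool_id (n1 * n2)"
  note c = bhom_cmap[OF g1 g2]
  \<comment> \<open>The generating relation of the coend, taken at the identity of
    \<open>2^[n1 * n2]\<close>.\<close>
  have "((d1, d2, ?c \<circ> ?i, x, y), (n1, n2, ?i, pmap (RR A) n1 d1 g1 x, pmap (RR B) n2 d2 g2 y))
      \<in> day_step (RR A) (RR B) (n1 * n2)"
    using day_stepI[OF g1 g2 bhom_bool_id x y] .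
  from day_class_step[OF this] have "day_class (RR A) (RR B) (n1 * n2) (d1, d2, ?c, x, y) = day_class (RR A) (RR B) (n1 * n2)
      (n1, n2, ?i, pmap (RR A) n1 d1 g1 x, pmap (RR B) n2 d2 g2 y)"
    unfolding comp_bool_id[OF c] .
  then show ?thesis
    using cocone_class[OF c x y S] by (simp add: pair_hom_def)
qed

text \<open>Frees \<open>cocone_bimorph\<close> from \<open>elem_hom\<close>: any \<open>x\<close>,
  \<open>y\<close> attaining the two elements may be used. Pull both back along the maps classifying
  \<open>U\<close> and \<open>V\<close>; their \<open>cmap\<close> sends the atom
  \<open>(1, 1)\<close> to the rectangle \<open>U \<times> V\<close>.\<close>

lemma cocone_bimorph_eq:
  assumes x: "x \<in> pob (RR A) n1" and y: "y \<in> pob (RR B) n2"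
    and U: "U \<subseteq> {1..n1}" and V: "V \<subseteq> {1..n2}"
  shows "cocone_bimorph A B phi (x U) (y V) =
    pair_hom A B phi n1 n2 x y (inj1 n1 n2 U \<inter> inj2 n1 n2 V)"
proof -
  obtain g1 where g1: "bhom 2 n1 g1" "g1 {1} = U" "pmap (RR A) 2 n1 g1 x = elem_hom A (x U)"
    using elem_hom_eq[OF A x U] .
  obtain g2 where g2: "bhom 2 n2 g2" "g2 {1} = V" "pmap (RR B) 2 n2 g2 y = elem_hom B (y V)"
    using elem_hom_eq[OF B y V] .
  have 1: "1 \<in> {1..2::nat}" by auto
  have "{enc 2 1 1} \<subseteq> {1..2 * 2}"
    using enc_closed[OF 1 1] by simp
  from pair_hom_cmap[OF g1(1) g2(1) x y this] show ?thesis
    by (simp only: cmap_atom[OF 1 1] g1 g2 cocone_bimorph_def inj1_Int_inj2_atom[OF 1 1])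
qed

lemma bimorph_cocone_bimorph: "bimorph A B D (cocone_bimorph A B phi)"
proof -
  have sub: "inj1 n1 n2 U \<inter> inj2 n1 n2 V \<subseteq> {1..n1 * n2}"
    if "U \<subseteq> {1..n1}" "V \<subseteq> {1..n2}" for n1 n2 U V
    using mem_inj1_Int_inj2[OF that] by blast
  have car: "cocone_bimorph A B phi a b \<in> ea_car D" if ab: "a \<in> ea_car A" "b \<in> ea_car B" for a b
    unfolding cocone_bimorph_def
    using bool_hom_simps(1)[OF ea_hom_pair_hom[OF elem_hom(1)[OF A ab(1)] elem_hom(1)[OF B ab(2)]] sub]
    by simp
  interpret A: effect_algebra A using A by unfold_locales
  interpret B: effect_algebra B using B by unfold_locales
  let ?x = "elem_hom A (ea_one A)" and ?y = "elem_hom B (ea_one B)"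
  note x = elem_hom(1)[OF A A.one_closed] and y = elem_hom(1)[OF B B.one_closed]
  \<comment> \<open>The units are values of \<open>elem_hom\<close> at the full set, and the full
    rectangle is the unit of \<open>2^[2 * 2]\<close>.\<close>
  have "inj1 2 2 {1..2} \<inter> inj2 2 2 {1..2} = {1..2 * 2}"
    using mem_inj1_Int_inj2[of "{1..2}" 2 "{1..2}" 2] dec_closed[of _ 2 2] by blast
  then have one: "cocone_bimorph A B phi (ea_one A) (ea_one B) = ea_one D"
    using cocone_bimorph_eq[OF x y order_refl order_refl]
      bool_hom_simps(2)[OF RR_hom[OF x]] bool_hom_simps(2)[OF RR_hom[OF y]]
      bool_hom_simps(2)[OF ea_hom_pair_hom[OF x y]] by simp
  have i1: "{1} \<subseteq> {1..2::nat}" by auto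
  have i3: "{1} \<subseteq> {1..3::nat}" "{2} \<subseteq> {1..3::nat}" "{1,2} \<subseteq> {1..3::nat}" by auto
  have left: "ea_sum D (cocone_bimorph A B phi a1 b) (cocone_bimorph A B phi a2 b) =
      Some (cocone_bimorph A B phi a b)"
    if ab: "b \<in> ea_car B" "a1 \<in> ea_car A" "a2 \<in> ea_car A" "ea_sum A a1 a2 = Some a" for a1 a2 a b
  proof -
    \<comment> \<open>One morphism from \<open>2^[3]\<close> attains \<open>a1\<close>,
      \<open>a2\<close> and their sum, so the law becomes additivity of a single
      \<open>pair_hom\<close> on two disjoint rectangles.\<close>
    obtain x where x: "x \<in> pob (RR A) 3" "x {1} = a1" "x {2} = a2" "x {1,2} = a"
      using A.ex_RR_3[OF ab(2-4)] .
    note y = elem_hom[OF B ab(1)]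
    let ?J = "\<lambda>U. inj1 3 2 U \<inter> inj2 3 2 {1}"
    note mem = inj1_Int_inj2_Collect[OF i3(1) i1] inj1_Int_inj2_Collect[OF i3(2) i1]
      inj1_Int_inj2_Collect[OF i3(3) i1]
    have "?J {1} \<inter> ?J {2} = {}" "?J {1} \<union> ?J {2} = ?J {1,2}"
      unfolding mem by auto
    then show ?thesis
      using bool_hom_simps(3)[OF ea_hom_pair_hom[OF x(1) y(1)] sub[OF i3(1) i1] sub[OF i3(2) i1]]
        cocone_bimorph_eq[OF x(1) y(1) i3(1) i1] cocone_bimorph_eq[OF x(1) y(1) i3(2) i1]
        cocone_bimorph_eq[OF x(1) y(1) i3(3) i1]
      unfolding x y by simp
  qed
  have right: "ea_sum D (cocone_bimorph A B phi a b1) (cocone_bimorph A B phi a b2) =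
      Some (cocone_bimorph A B phi a b)"
    if ab: "a \<in> ea_car A" "b1 \<in> ea_car B" "b2 \<in> ea_car B" "ea_sum B b1 b2 = Some b" for b1 b2 a b
  proof -
    obtain y where y: "y \<in> pob (RR B) 3" "y {1} = b1" "y {2} = b2" "y {1,2} = b"
      using B.ex_RR_3[OF ab(2-4)] .
    note x = elem_hom[OF A ab(1)]
    let ?J = "\<lambda>V. inj1 2 3 {1} \<inter> inj2 2 3 V"
    note mem = inj1_Int_inj2_Collect[OF i1 i3(1)] inj1_Int_inj2_Collect[OF i1 i3(2)]
      inj1_Int_inj2_Collect[OF i1 i3(3)]
    have "?J {1} \<inter> ?J {2} = {}" "?J {1} \<union> ?J {2} = ?J {1,2}"
      unfolding mem by auto
    then show ?thesis
      using bool_hom_simps(3)[OF ea_hom_pair_hom[OF x(1) y(1)] sub[OF i1 i3(1)] sub[OF i1 i3(2)]]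
        cocone_bimorph_eq[OF x(1) y(1) i1 i3(1)] cocone_bimorph_eq[OF x(1) y(1) i1 i3(2)]
        cocone_bimorph_eq[OF x(1) y(1) i1 i3(3)]
      unfolding x y by simp
  qed
  show ?thesis
    using car one left right unfolding bimorph_def by blast
qed

end

section \<open>Comparison of the universal objects\<close>

lemma ea_hom_comp: "ea_hom P Q f \<Longrightarrow> ea_hom Q R g \<Longrightarrow> ea_hom P R (g \<circ> f)"
  by (simp add: ea_hom_def)

lemma ea_hom_id: "ea_hom P P id"
  by (simp add: ea_hom_def)

section \<open>Universal properties of the tensor product and of the colimit\<close>

lemma is_tensorD:
  assumes "is_tensor A B C h TYPE('d)"
  shows "effect_alg C" "bimorph A B C h"
  using assms[unfolded is_tensor_def, THEN conjunct1]
    assms[unfolded is_tensor_def, THEN conjunct2, THEN conjunct1] .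

lemma is_tensor_universal:
  fixes D :: "'d ea"
  assumes "is_tensor A B C h TYPE('d)" "effect_alg D" "bimorph A B D k"
  shows "\<exists>u. ea_hom C D u \<and> (\<forall>a\<in>ea_car A. \<forall>b\<in>ea_car B. u (h a b) = k a b)"
    and "\<forall>u v. ea_hom C D u \<and> (\<forall>a\<in>ea_car A. \<forall>b\<in>ea_car B. u (h a b) = k a b) \<and>
      ea_hom C D v \<and> (\<forall>a\<in>ea_car A. \<forall>b\<in>ea_car B. v (h a b) = k a b) \<longrightarrow> (\<forall>z\<in>ea_car C. u z = v z)"
proof -
  note univ = assms(1)[unfolded is_tensor_def, THEN conjunct2, THEN conjunct2, THEN spec, THEN spec,
    THEN mp, OF conjI[OF assms(2,3)]]
  show "\<exists>u. ea_hom C D u \<and> (\<forall>a\<in>ea_car A. \<forall>b\<in>ea_car B. u (h a b) = k a b)"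
    by (rule univ[THEN conjunct1])
  show "\<forall>u v. ea_hom C D u \<and> (\<forall>a\<in>ea_car A. \<forall>b\<in>ea_car B. u (h a b) = k a b) \<and>
      ea_hom C D v \<and> (\<forall>a\<in>ea_car A. \<forall>b\<in>ea_car B. v (h a b) = k a b) \<longrightarrow> (\<forall>z\<in>ea_car C. u z = v z)"
    by (rule univ[THEN conjunct2])
qed

text \<open>Both \<open>u\<close> and \<open>id\<close> factor \<open>h\<close> through itself, so
  uniqueness with target \<open>C\<close> identifies them.\<close>

lemma is_tensor_endo_id:
  fixes C :: "'c ea"
  assumes "is_tensor A B C h TYPE('c)" "ea_hom C C u"
    and "\<And>a b. a \<in> ea_car A \<Longrightarrow> b \<in> ea_car B \<Longrightarrow> u (h a b) = h a b" and "z \<in> ea_car C"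
  shows "u z = z"
  using is_tensor_universal(2)[OF assms(1) is_tensorD[OF assms(1)], rule_format, of u id z] assms(2-)
  by (simp add: ea_hom_id)

lemma is_colimitD:
  assumes "is_colimit P L lam TYPE('d)"
  shows "effect_alg L" "cocone P L lam"
  using assms[unfolded is_colimit_def, THEN conjunct1]
    assms[unfolded is_colimit_def, THEN conjunct2, THEN conjunct1] .

lemma is_colimit_universal:
  fixes D :: "'d ea"
  assumes "is_colimit P L lam TYPE('d)" "effect_alg D" "cocone P D phi"
  shows "\<exists>u. ea_hom L D u \<and>
      (\<forall>n x. x \<in> pob P n \<longrightarrow> (\<forall>S\<in>Pow {1..n}. u (lam n x S) = phi n x S))"
    and "\<forall>u v. ea_hom L D u \<and>
      (\<forall>n x. x \<in> pob P n \<longrightarrow> (\<forall>S\<in>Pow {1..n}. u (lam n x S) = phi n x S)) \<and> ea_hom L D v \<and>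
      (\<forall>n x. x \<in> pob P n \<longrightarrow> (\<forall>S\<in>Pow {1..n}. v (lam n x S) = phi n x S)) \<longrightarrow>
      (\<forall>z\<in>ea_car L. u z = v z)"
proof -
  note univ = assms(1)[unfolded is_colimit_def, THEN conjunct2, THEN conjunct2, THEN spec, THEN spec,
    THEN mp, OF conjI[OF assms(2,3)]]
  show "\<exists>u. ea_hom L D u \<and>
      (\<forall>n x. x \<in> pob P n \<longrightarrow> (\<forall>S\<in>Pow {1..n}. u (lam n x S) = phi n x S))"
    by (rule univ[THEN conjunct1])
  show "\<forall>u v. ea_hom L D u \<and>
      (\<forall>n x. x \<in> pob P n \<longrightarrow> (\<forall>S\<in>Pow {1..n}. u (lam n x S) = phi n x S)) \<and> ea_hom L D v \<and>
      (\<forall>n x. x \<in> pob P n \<longrightarrow> (\<forall>S\<in>Pow {1..n}. v (lam n x S) = phi n x S)) \<longrightarrow>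
      (\<forall>z\<in>ea_car L. u z = v z)"
    by (rule univ[THEN conjunct2])
qed

lemma is_colimit_endo_id:
  fixes L :: "'l ea"
  assumes "is_colimit P L lam TYPE('l)" "ea_hom L L u"
    and "\<And>n x S. x \<in> pob P n \<Longrightarrow> S \<in> Pow {1..n} \<Longrightarrow> u (lam n x S) = lam n x S"
    and "z \<in> ea_car L"
  shows "u z = z"
  using is_colimit_universal(2)[OF assms(1) is_colimitD[OF assms(1)], rule_format, of u id z] assms(2-)
  by (simp add: ea_hom_id)

theorem mainTheorem9:
  fixes A :: "'a ea" and B :: "'b ea"
    and C :: "'c ea" and h :: "'a \<Rightarrow> 'b \<Rightarrow> 'c"
    and L :: "'l ea"
    and lam :: "nat \<Rightarrow> ((nat set \<Rightarrow> 'a), (nat set \<Rightarrow> 'b)) dtuple set \<Rightarrow> nat set \<Rightarrow> 'l"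
  assumes "effect_alg A" and "effect_alg B"
    and "is_tensor A B C h TYPE('c)" and "is_tensor A B C h TYPE('l)"
    and "is_colimit (Day (RR A) (RR B)) L lam TYPE('c)"
    and "is_colimit (Day (RR A) (RR B)) L lam TYPE('l)"
  shows "ea_iso C L"
proof -
  let ?P = "Day (RR A) (RR B)"
  have C: "effect_alg C" and h: "bimorph A B C h"
    using is_tensorD[OF assms(3)] .
  have L: "effect_alg L" and lam: "cocone ?P L lam"
    using is_colimitD[OF assms(5)] .
  interpret C: effect_algebra C using C by unfold_locales
  interpret L: effect_algebra L using L by unfold_locales
  let ?\<phi> = "bimorph_cocone C h" and ?k = "cocone_bimorph A B lam"
  \<comment> \<open>The colimit property applied to the cocone induced by \<open>h\<close> gives
    \<open>u\<close>; the tensor property applied to the bimorphism induced by \<open>lam\<close>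
    gives \<open>v\<close>.\<close>
  obtain u where u: "ea_hom L C u"
    and u_lam: "\<And>n c S. c \<in> pob ?P n \<Longrightarrow> S \<in> Pow {1..n} \<Longrightarrow> u (lam n c S) = ?\<phi> n c S"
    using is_colimit_universal(1)[OF assms(5) C C.cocone_bimorph_cocone[OF h]] by blast
  obtain v where v: "ea_hom C L v"
    and v_h: "\<And>a b. a \<in> ea_car A \<Longrightarrow> b \<in> ea_car B \<Longrightarrow> v (h a b) = ?k a b"
    using is_tensor_universal(1)[OF assms(4) L bimorph_cocone_bimorph[OF assms(1,2) lam]] by blast
  have u_pair: "u (pair_hom A B lam n1 n2 x y S) = tensor_hom C h n1 n2 x y S"
    if "x \<in> pob (RR A) n1" "y \<in> pob (RR B) n2" "S \<subseteq> {1..n1 * n2}" for n1 n2 x y S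
  proof -
    let ?c = "day_class (RR A) (RR B) (n1 * n2) (n1, n2, bool_id (n1 * n2), x, y)"
    have "?c \<in> pob ?P (n1 * n2)"
      using that bhom_bool_id by (intro day_class_in_Day)
    then have "u (pair_hom A B lam n1 n2 x y S) = ?\<phi> (n1 * n2) ?c S"
      using u_lam that(3) by (simp add: pair_hom_def)
    then show ?thesis
      using that(3) by (simp add: C.bimorph_cocone_class[OF h] bool_id_def)
  qed
  \<comment> \<open>Unfolding \<open>?k a b\<close> as a value of \<open>pair_hom\<close>,
    \<open>u\<close> turns it into \<open>tensor_hom\<close> at the rectangle
    \<open>{1} \<times> {1}\<close>, which is \<open>h a b\<close>.\<close>
  have uv: "(u \<circ> v) (h a b) = h a b" if ab: "a \<in> ea_car A" "b \<in> ea_car B" for a b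
  proof -
    note x = elem_hom[OF assms(1) ab(1)] and y = elem_hom[OF assms(2) ab(2)]
    have 1: "{1} \<subseteq> {1..2::nat}" by auto
    have "inj1 2 2 {1} \<inter> inj2 2 2 {1} \<subseteq> {1..2 * 2}"
      using mem_inj1_Int_inj2[OF 1 1] by blast
    then have "u (?k a b) = tensor_hom C h 2 2 (elem_hom A a) (elem_hom B b) (inj1 2 2 {1} \<inter> inj2 2 2 {1})"
      unfolding cocone_bimorph_def using u_pair x y by blast
    also have "\<dots> = h a b"
      using C.tensor_hom(2)[OF h RR_hom[OF x(1)] RR_hom[OF y(1)] 1 1] unfolding x y .
    finally show ?thesis
      by (simp add: v_h[OF ab])
  qed
  \<comment> \<open>Reduce to a representative: \<open>u\<close> sends \<open>lam n c S\<close> to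
    \<open>tensor_hom\<close> at \<open>f S\<close>, and \<open>v\<close> after
    \<open>tensor_hom\<close> agrees with \<open>pair_hom\<close> because both are morphisms with
    the same values on atoms.\<close>
  have vu: "(v \<circ> u) (lam n c S) = lam n c S" if c: "c \<in> pob ?P n" and S: "S \<in> Pow {1..n}" for n c S
  proof -
    obtain n1 n2 f x y where c_eq: "c = day_class (RR A) (RR B) n (n1, n2, f, x, y)"
      and f: "bhom n (n1 * n2) f" and x: "x \<in> pob (RR A) n1" and y: "y \<in> pob (RR B) n2"
      using c by (rule in_DayE)
    note p = ea_hom_pair_hom[OF assms(1,2) lam x y]
    have "(v \<circ> tensor_hom C h n1 n2 x y) T = pair_hom A B lam n1 n2 x y T"
      if "T \<subseteq> {1..n1 * n2}" for T
    proof (rule L.bool_prod_hom_eqI[OF _ p _ that])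
      show "ea_hom (boolEA (n1 * n2)) L (v \<circ> tensor_hom C h n1 n2 x y)"
        using ea_hom_comp[OF C.tensor_hom(1)[OF h RR_hom[OF x] RR_hom[OF y]] v] .
      fix a b assume ab: "a \<in> {1..n1}" "b \<in> {1..n2}"
      then have ab': "{a} \<subseteq> {1..n1}" "{b} \<subseteq> {1..n2}" by auto
      have "tensor_hom C h n1 n2 x y {enc n2 a b} = h (x {a}) (y {b})"
        using C.tensor_hom(2)[OF h RR_hom[OF x] RR_hom[OF y] ab']
        by (simp only: inj1_Int_inj2_atom[OF ab])
      moreover have "x {a} \<in> ea_car A" "y {b} \<in> ea_car B"
        using bool_hom_simps(1)[OF RR_hom[OF x] ab'(1)] bool_hom_simps(1)[OF RR_hom[OF y] ab'(2)] .
      ultimately have "v (tensor_hom C h n1 n2 x y {enc n2 a b}) = ?k (x {a}) (y {b})"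
        by (simp add: v_h)
      then show "(v \<circ> tensor_hom C h n1 n2 x y) {enc n2 a b} = pair_hom A B lam n1 n2 x y {enc n2 a b}"
        using cocone_bimorph_eq[OF assms(1,2) lam x y ab']
        by (simp add: inj1_Int_inj2_atom[OF ab])
    qed
    note this[OF bhom_subset[OF f, of S]]
    moreover have "lam n c S = pair_hom A B lam n1 n2 x y (f S)"
      unfolding c_eq using cocone_class[OF assms(1,2) lam f x y] S by simp
    moreover have "u (lam n c S) = tensor_hom C h n1 n2 x y (f S)"
      using u_lam[OF c S] by (simp add: c_eq C.bimorph_cocone_class[OF h])
    ultimately show ?thesis by simp
  qed
  \<comment> \<open>Each composite fixes the universal family, hence is the identity on the whole
    carrier.\<close>
  have "(u \<circ> v) z = z" if "z \<in> ea_car C" for z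
    using is_tensor_endo_id[OF assms(3) ea_hom_comp[OF v u] uv that] .
  moreover have "(v \<circ> u) z = z" if "z \<in> ea_car L" for z
    using is_colimit_endo_id[OF assms(6) ea_hom_comp[OF u v] vu that] .
  ultimately show ?thesis
    using u v unfolding ea_iso_def by auto
qed

end
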